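(* Let $\{(x^k,\tilde x^{k+1},z^k,y^k)\}_{k\ge 0}$ be an infinite sequence generated by the inexact ADMM scheme described in the context, with constants $\rho,\beta_x,\beta_z,c_x,c_z>0$ and $\delta\in(0,1)$; that is, for every $k\ge 0$ conditions (X1), (X2), (Z1), (Z2), (Y), (S) of the context hold. Assume that every $z\in\mathbb{R}^m$ satisfies $z\in\mathrm{Range}(A)$, and that $R^{k}\neq0$ for all $k\ge1$. Let $0<\tau<\delta<1$ and suppose that $$\left[\frac{\beta_x(1-\tau)}{2(1+\tau)}-\frac{2\left(\frac{\sigma_Q^{\max}}{\rho}+c_x\right)^2+8c_x^2}{\sigma^{\min}_{A^\top A}}\right]I\succeq 0,\quad \left[\frac{\delta-\tau}{1+\tau}-\frac{8\left(\frac{\sigma_Q^{\max}}{\rho}\right)^2}{\sigma^{\min}_{A^\top A}}\right]I\succeq 0,\quad \left[\frac{\beta_z(1-\tau)}{2(1+\tau)}-16\,\kappa(A^\top A)\right]I\succeq 0,$$ and that the sequence $\{\tilde E^k\}_{k\ge1}$ is bounded below. Then there exists $F^*\in\mathbb{R}$ such that $$\lim_{k\to\infty}\mathcal L(x^k,z^k,y^k)=\lim_{k\to\infty}\mathcal L_\rho(x^k,z^k,y^k)=\lim_{k\to\infty}E^k=\lim_{k\to\infty}\tilde E^k=F^*,$$ and $$\lim_{k\to\infty}\mathrm{dist}\left(0,\partial\mathcal L(x^k,z^k,y^k)\right)=\lim_{k\to\infty}\mathrm{dist}\left(0,\partial\mathcal L_\rho(x^k,z^k,y^k)\right)=0.$$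 Moreover, let $(x^*,z^*,y^* )$ be a limit point of the sequence $\{(x^k,z^k,y^k)\}$. Then $\{(x^k,z^k,y^k)\}$ converges sublinearly (in the sense specified in the context) to $(x^*,z^*,y^* )$, and $(x^*,z^*,y^* )$ is optimal, meaning that $x^*$ is an optimal solution of $\min_{x\in\mathbb{R}^n}\frac12x^\top Qx+p^\top x$ subject to $l\le Ax\le u$, with $z^*=Ax^*$.
   Context: Problem data: $Q\in\mathbb{R}^{n\times n}$ symmetric positive semidefinite, $p\in\mathbb{R}^n$, $A\in\mathbb{R}^{m\times n}$, bounds $l_i\in\mathbb{R}\cup\{-\infty\}$, $u_i\in\mathbb{R}\cup\{+\infty\}$ for $i=1,\dots,m$. The convex quadratic program is $\min_{x\in\mathbb{R}^n}\frac12x^\top Qx+p^\top x$ subject to $l\le Ax\le u$, rewritten as $\min_{x,z} f(x)+g(z)$ subject to $Ax=z$, where $f(x)=\frac12x^\top Qx+p^\top x$ and $g(z)=\mathbb{I}_{l\le z\le u}(z)$ is the indicator function ($0$ if $l\le z\le u$, $+\infty$ otherwise). For $\rho>0$ set $$\mathcal L(x,z,y)=f(x)+g(z)+y^\top(Ax-z),\qquad \mathcal L_\rho(x,z,y)=\mathcal L(x,z,y)+\frac{\rho}{2}\|Ax-z\|^2,$$ with $\|\cdot\|$ the Euclidean norm. (Values may be $+\infty$ when $z\notin[l,u]$; $\nabla_x\mathcal L_\rho(x,z,y)=\nabla f(x)+A^\top y+\rho A^\top(Ax-z)$ is the gradient in $x$ of the smooth part; $\partial_z\mathcal L_\rho(x,z,y)=\partial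 g(z)-y-\rho(Ax-z)$, with $\partial g(z)$ the convex subdifferential.) The full subdifferentials are $$\partial\mathcal L(x,z,y)=\{\nabla f(x)+A^\top y\}\times(\partial g(z)-y)\times\{Ax-z\},$$ $$\partial\mathcal L_\rho(x,z,y)=\{\nabla f(x)+A^\top y+\rho A^\top(Ax-z)\}\times(\partial g(z)-y-\rho(Ax-z))\times\{Ax-z\},$$ and $\mathrm{dist}(v,\mathcal C)=\inf_{w\in\mathcal C}\|v-w\|$. Inexact ADMM scheme: starting from $(x^0,z^0,y^0)\in\mathbb{R}^n\times\mathbb{R}^m\times\mathbb{R}^m$, for every $k\ge0$ the iterates satisfy: (X1) $\mathcal L_\rho(\tilde x^{k+1},z^k,y^k)+\frac{\rho\beta_x}{2}\|\tilde x^{k+1}-x^k\|^2\le\mathcal L_\rho(x^k,z^k,y^k)$. (X2) $\|\xi_x^{k+1}\|\le c_x\rho\|\tilde x^{k+1}-x^k\|$, where $\xi_x^{k+1}:=\nabla_x\mathcal L_\rho(\tilde x^{k+1},z^k,y^k)$. (Z1) $\mathcal L_\rho(\tilde x^{k+1},z^{k+1},y^k)+\frac{\rho\beta_z}{2}\|z^{k+1}-z^k\|^2\le\mathcal L_\rho(\tilde x^{k+1},z^k,y^k)$. (Z2) there is $\xi_z^{k+1}\in\partial_z\mathcal L_\rho(\tilde x^{k+1},z^{k+1},y^k)$ with $\|\xi_z^{k+1}\|\le c_z\rho\left(\|z^{k+1}-z^k\|+\|\tilde x^{k+1}-x^k\|\right)$. (Y) $y^{k+1}=y^k+\rho(A\tilde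 x^{k+1}-z^{k+1})$. (S) $x^{k+1}=\alpha^k\tilde x^{k+1}+(1-\alpha^k)x^k$ with $\alpha^k\in(0,2)$ such that $\mathcal L_\rho(x^{k+1},z^{k+1},y^{k+1})\le\mathcal L_\rho(\tilde x^{k+1},z^{k+1},y^{k+1})-\delta\rho\|x^{k+1}-\tilde x^{k+1}\|^2$. The residual is $R^{k+1}=\|\tilde x^{k+1}-x^k\|+\|z^{k+1}-z^k\|+\|A\tilde x^{k+1}-z^{k+1}\|$ for $k\ge0$. Notation: $\tilde d_x^k=\tilde x^{k+1}-x^k$, $\hat d_x^k=x^{k+1}-\tilde x^{k+1}$, $d_z^k=z^{k+1}-z^k$ for $k\ge0$. $\sigma_Q^{\max}>0$ is the largest eigenvalue of $Q$; $\sigma^{\min}_{A^\top A}$ is the smallest positive eigenvalue and $\sigma^{\max}_{A^\top A}$ the largest eigenvalue of $A^\top A$; $\kappa(A^\top A)=\sigma^{\max}_{A^\top A}/\sigma^{\min}_{A^\top A}$. $I$ is the identity matrix, and $\succeq0$ means positive semidefinite. Energies, for $k\ge0$: $$\tilde\Gamma^k=\frac{8(1+\tau)c_x^2\rho}{\sigma^{\min}_{A^\top A}}\|\tilde d_x^k\|^2+8(1+\tau)\rho\,\kappa(A^\top A)\|d_z^k\|^2,\qquad \Gamma^k=\tilde\Gamma^k+\frac{8(1+\tau)(\sigma_Q^{\max})^2}{\rho\,\sigma^{\min}_{A^\top A}}\|\hat d_x^k\|^2,$$ $$\tilde E^{k+1}=\mathcal L_\rho(\tilde x^{k+1},z^{k+1},y^{k+1})+\tilde\Gamma^k,\qquad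 E^{k+1}=\mathcal L_\rho(x^{k+1},z^{k+1},y^{k+1})+\Gamma^k.$$ Meaning of "converges sublinearly to $(x^*,z^*,y^* )$": $(x^k,z^k,y^k)\to(x^*,z^*,y^* )$ as $k\to\infty$, and the stationarity measure decays at the sublinear rate $\min_{1\le k\le K}\mathrm{dist}\left(0,\partial\mathcal L(x^k,z^k,y^k)\right)=\mathcal O(1/\sqrt K)$ as $K\to\infty$. *)

theory Defs
  imports "HOL-Analysis.Analysis"
begin

section \<open>Matrices\<close>

definition eigenvalues :: "real^'n^'n \<Rightarrow> real set" where
  "eigenvalues M = {c. \<exists>v. v \<noteq> 0 \<and> M *v v = c *\<^sub>R v}"

definition sigma_max :: "real^'n^'n \<Rightarrow> real" where
  "sigma_max M = Max (eigenvalues M)"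

definition sigma_min :: "real^'n^'n \<Rightarrow> real" where
  "sigma_min M = Min {c \<in> eigenvalues M. 0 < c}"

definition kappa :: "real^'n^'n \<Rightarrow> real" where
  "kappa M = sigma_max M / sigma_min M"

definition psd :: "real^'n^'n \<Rightarrow> bool" where
  "psd M \<longleftrightarrow> transpose M = M \<and> (\<forall>v. 0 \<le> v \<bullet> (M *v v))"

section \<open>Gradient, convex subdifferential, distance to a set\<close>

definition grad :: "('a::real_inner \<Rightarrow> real) \<Rightarrow> 'a \<Rightarrow> 'a" where
  "grad h x = (THE D. GDERIV h x :> D)"

text \<open>The subdifferential is empty at points where the function is not finite.\<close>

definition subdifferential :: "('a::real_inner \<Rightarrow> ereal) \<Rightarrow> 'a \<Rightarrow> 'a set" where
  "subdifferential h z =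
     {v. \<bar>h z\<bar> \<noteq> \<infinity> \<and> (\<forall>w. h z + ereal (v \<bullet> (w - z)) \<le> h w)}"

text \<open>Extended-real valued, so that the distance to the empty set is \<open>\<infinity>\<close>
  (the library's \<open>infdist\<close> would give \<open>0\<close> there).\<close>

definition edist :: "'a::real_normed_vector \<Rightarrow> 'a set \<Rightarrow> ereal" where
  "edist v C = (INF w\<in>C. ereal (norm (v - w)))"

section \<open>The quadratic program and its Lagrangians\<close>

definition feasible_box :: "ereal^'m \<Rightarrow> ereal^'m \<Rightarrow> (real^'m) set" where
  "feasible_box l u = {z. \<forall>i. l $ i \<le> ereal (z $ i) \<and> ereal (z $ i) \<le> u $ i}"

definition qp_f :: "real^'n^'n \<Rightarrow> real^'n \<Rightarrow> real^'n \<Rightarrow> real" where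
  "qp_f Q p x = 1/2 * (x \<bullet> (Q *v x)) + p \<bullet> x"

definition qp_g :: "ereal^'m \<Rightarrow> ereal^'m \<Rightarrow> real^'m \<Rightarrow> ereal" where
  "qp_g l u z = (if z \<in> feasible_box l u then 0 else \<infinity>)"

definition qp_optimal ::
  "real^'n^'n \<Rightarrow> real^'n \<Rightarrow> real^'n^'m \<Rightarrow> ereal^'m \<Rightarrow> ereal^'m \<Rightarrow> real^'n \<Rightarrow> bool" where
  "qp_optimal Q p A l u x \<longleftrightarrow>
     A *v x \<in> feasible_box l u \<and>
     (\<forall>x'. A *v x' \<in> feasible_box l u \<longrightarrow> qp_f Q p x \<le> qp_f Q p x')"

definition Lagr ::
  "real^'n^'n \<Rightarrow> real^'n \<Rightarrow> real^'n^'m \<Rightarrow> ereal^'m \<Rightarrow> ereal^'m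
    \<Rightarrow> real^'n \<Rightarrow> real^'m \<Rightarrow> real^'m \<Rightarrow> ereal" where
  "Lagr Q p A l u x z y =
     ereal (qp_f Q p x) + qp_g l u z + ereal (y \<bullet> (A *v x - z))"

definition AugLagr ::
  "real^'n^'n \<Rightarrow> real^'n \<Rightarrow> real^'n^'m \<Rightarrow> ereal^'m \<Rightarrow> ereal^'m \<Rightarrow> real
    \<Rightarrow> real^'n \<Rightarrow> real^'m \<Rightarrow> real^'m \<Rightarrow> ereal" where
  "AugLagr Q p A l u \<rho> x z y =
     Lagr Q p A l u x z y + ereal (\<rho> / 2 * (norm (A *v x - z))\<^sup>2)"

text \<open>Gradient in \<open>x\<close> of the smooth part of the augmented Lagrangian.\<close>

definition grad_x_AugLagr ::
  "real^'n^'n \<Rightarrow> real^'n \<Rightarrow> real^'n^'m \<Rightarrow> real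
    \<Rightarrow> real^'n \<Rightarrow> real^'m \<Rightarrow> real^'m \<Rightarrow> real^'n" where
  "grad_x_AugLagr Q p A \<rho> x z y =
     grad (qp_f Q p) x + transpose A *v y + \<rho> *\<^sub>R (transpose A *v (A *v x - z))"

definition subdiff_z_AugLagr ::
  "real^'n^'m \<Rightarrow> ereal^'m \<Rightarrow> ereal^'m \<Rightarrow> real
    \<Rightarrow> real^'n \<Rightarrow> real^'m \<Rightarrow> real^'m \<Rightarrow> (real^'m) set" where
  "subdiff_z_AugLagr A l u \<rho> x z y =
     (\<lambda>v. v - y - \<rho> *\<^sub>R (A *v x - z)) ` subdifferential (qp_g l u) z"

text \<open>The norm of the product type is the Euclidean norm of the triple.\<close>

definition subdiff_Lagr ::
  "real^'n^'n \<Rightarrow> real^'n \<Rightarrow> real^'n^'m \<Rightarrow> ereal^'m \<Rightarrow> ereal^'m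
    \<Rightarrow> real^'n \<Rightarrow> real^'m \<Rightarrow> real^'m \<Rightarrow> ((real^'n) \<times> (real^'m) \<times> (real^'m)) set" where
  "subdiff_Lagr Q p A l u x z y =
     {grad (qp_f Q p) x + transpose A *v y}
       \<times> ((\<lambda>v. v - y) ` subdifferential (qp_g l u) z)
       \<times> {A *v x - z}"

definition subdiff_AugLagr ::
  "real^'n^'n \<Rightarrow> real^'n \<Rightarrow> real^'n^'m \<Rightarrow> ereal^'m \<Rightarrow> ereal^'m \<Rightarrow> real
    \<Rightarrow> real^'n \<Rightarrow> real^'m \<Rightarrow> real^'m \<Rightarrow> ((real^'n) \<times> (real^'m) \<times> (real^'m)) set" where
  "subdiff_AugLagr Q p A l u \<rho> x z y =
     {grad_x_AugLagr Q p A \<rho> x z y}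
       \<times> subdiff_z_AugLagr A l u \<rho> x z y
       \<times> {A *v x - z}"

section \<open>The inexact ADMM scheme\<close>

text \<open>Throughout, \<open>xt\<close> is the sequence of the \<open>\<tilde>x\<close>-iterates, of which only the terms
  \<open>xt 1, xt 2, ...\<close> are meaningful; \<open>xt 0\<close> is an unconstrained dummy value.\<close>

definition inexact_admm ::
  "real^'n^'n \<Rightarrow> real^'n \<Rightarrow> real^'n^'m \<Rightarrow> ereal^'m \<Rightarrow> ereal^'m
    \<Rightarrow> real \<Rightarrow> real \<Rightarrow> real \<Rightarrow> real \<Rightarrow> real \<Rightarrow> real
    \<Rightarrow> (nat \<Rightarrow> real^'n) \<Rightarrow> (nat \<Rightarrow> real^'n) \<Rightarrow> (nat \<Rightarrow> real^'m) \<Rightarrow> (nat \<Rightarrow> real^'m) \<Rightarrow> bool" where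
  "inexact_admm Q p A l u \<rho> \<beta>x \<beta>z cx cz \<delta> x xt z y \<longleftrightarrow>
    (\<forall>k.
      AugLagr Q p A l u \<rho> (xt (Suc k)) (z k) (y k)
          + ereal (\<rho> * \<beta>x / 2 * (norm (xt (Suc k) - x k))\<^sup>2)
        \<le> AugLagr Q p A l u \<rho> (x k) (z k) (y k)
    \<and> norm (grad_x_AugLagr Q p A \<rho> (xt (Suc k)) (z k) (y k))
        \<le> cx * \<rho> * norm (xt (Suc k) - x k)
    \<and> AugLagr Q p A l u \<rho> (xt (Suc k)) (z (Suc k)) (y k)
          + ereal (\<rho> * \<beta>z / 2 * (norm (z (Suc k) - z k))\<^sup>2)
        \<le> AugLagr Q p A l u \<rho> (xt (Suc k)) (z k) (y k)
    \<and> (\<exists>\<xi> \<in> subdiff_z_AugLagr A l u \<rho> (xt (Suc k)) (z (Suc k)) (y k).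
          norm \<xi> \<le> cz * \<rho> * (norm (z (Suc k) - z k) + norm (xt (Suc k) - x k)))
    \<and> y (Suc k) = y k + \<rho> *\<^sub>R (A *v xt (Suc k) - z (Suc k))
    \<and> (\<exists>\<alpha>. 0 < \<alpha> \<and> \<alpha> < 2 \<and>
          x (Suc k) = \<alpha> *\<^sub>R xt (Suc k) + (1 - \<alpha>) *\<^sub>R x k \<and>
          AugLagr Q p A l u \<rho> (x (Suc k)) (z (Suc k)) (y (Suc k))
            \<le> AugLagr Q p A l u \<rho> (xt (Suc k)) (z (Suc k)) (y (Suc k))
              - ereal (\<delta> * \<rho> * (norm (x (Suc k) - xt (Suc k)))\<^sup>2)))"

text \<open>\<open>residual A x xt z k\<close> is $R^{k+1}$.\<close>

definition residual ::
  "real^'n^'m \<Rightarrow> (nat \<Rightarrow> real^'n) \<Rightarrow> (nat \<Rightarrow> real^'n) \<Rightarrow> (nat \<Rightarrow> real^'m) \<Rightarrow> nat \<Rightarrow> real" where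
  "residual A x xt z k =
     norm (xt (Suc k) - x k) + norm (z (Suc k) - z k) + norm (A *v xt (Suc k) - z (Suc k))"

definition Gamma_tilde ::
  "real^'n^'m \<Rightarrow> real \<Rightarrow> real \<Rightarrow> real
    \<Rightarrow> (nat \<Rightarrow> real^'n) \<Rightarrow> (nat \<Rightarrow> real^'n) \<Rightarrow> (nat \<Rightarrow> real^'m) \<Rightarrow> nat \<Rightarrow> real" where
  "Gamma_tilde A \<rho> cx \<tau> x xt z k =
     8 * (1 + \<tau>) * cx\<^sup>2 * \<rho> / sigma_min (transpose A ** A) * (norm (xt (Suc k) - x k))\<^sup>2
     + 8 * (1 + \<tau>) * \<rho> * kappa (transpose A ** A) * (norm (z (Suc k) - z k))\<^sup>2"

definition Gamma_full ::
  "real^'n^'n \<Rightarrow> real^'n^'m \<Rightarrow> real \<Rightarrow> real \<Rightarrow> real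
    \<Rightarrow> (nat \<Rightarrow> real^'n) \<Rightarrow> (nat \<Rightarrow> real^'n) \<Rightarrow> (nat \<Rightarrow> real^'m) \<Rightarrow> nat \<Rightarrow> real" where
  "Gamma_full Q A \<rho> cx \<tau> x xt z k =
     Gamma_tilde A \<rho> cx \<tau> x xt z k
     + 8 * (1 + \<tau>) * (sigma_max Q)\<^sup>2 / (\<rho> * sigma_min (transpose A ** A))
       * (norm (x (Suc k) - xt (Suc k)))\<^sup>2"

text \<open>The argument \<open>k\<close> of the two energies is the index of the energy itself
  ($\tilde E^k$ and $E^k$), which is meaningful only for \<open>k \<ge> 1\<close>.\<close>

definition E_tilde ::
  "real^'n^'n \<Rightarrow> real^'n \<Rightarrow> real^'n^'m \<Rightarrow> ereal^'m \<Rightarrow> ereal^'m \<Rightarrow> real \<Rightarrow> real \<Rightarrow> real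
    \<Rightarrow> (nat \<Rightarrow> real^'n) \<Rightarrow> (nat \<Rightarrow> real^'n) \<Rightarrow> (nat \<Rightarrow> real^'m) \<Rightarrow> (nat \<Rightarrow> real^'m)
    \<Rightarrow> nat \<Rightarrow> ereal" where
  "E_tilde Q p A l u \<rho> cx \<tau> x xt z y k =
     AugLagr Q p A l u \<rho> (xt k) (z k) (y k) + ereal (Gamma_tilde A \<rho> cx \<tau> x xt z (k - 1))"

definition E_full ::
  "real^'n^'n \<Rightarrow> real^'n \<Rightarrow> real^'n^'m \<Rightarrow> ereal^'m \<Rightarrow> ereal^'m \<Rightarrow> real \<Rightarrow> real \<Rightarrow> real
    \<Rightarrow> (nat \<Rightarrow> real^'n) \<Rightarrow> (nat \<Rightarrow> real^'n) \<Rightarrow> (nat \<Rightarrow> real^'m) \<Rightarrow> (nat \<Rightarrow> real^'m)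
    \<Rightarrow> nat \<Rightarrow> ereal" where
  "E_full Q p A l u \<rho> cx \<tau> x xt z y k =
     AugLagr Q p A l u \<rho> (x k) (z k) (y k) + ereal (Gamma_full Q A \<rho> cx \<tau> x xt z (k - 1))"

section \<open>Sublinear convergence\<close>

text \<open>The second conjunct unfolds the rate
  $\min_{1 \le k \le K} \mathrm{dist}(0, \partial L(x^k,z^k,y^k)) = O(1/\sqrt K)$;
  the constant \<open>C\<close> is real, so the minimum is in particular finite for large \<open>K\<close>.\<close>

definition converges_sublinearly ::
  "real^'n^'n \<Rightarrow> real^'n \<Rightarrow> real^'n^'m \<Rightarrow> ereal^'m \<Rightarrow> ereal^'m
    \<Rightarrow> (nat \<Rightarrow> real^'n) \<Rightarrow> (nat \<Rightarrow> real^'m) \<Rightarrow> (nat \<Rightarrow> real^'m)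
    \<Rightarrow> real^'n \<Rightarrow> real^'m \<Rightarrow> real^'m \<Rightarrow> bool" where
  "converges_sublinearly Q p A l u x z y xs zs ys \<longleftrightarrow>
     (\<lambda>k. (x k, z k, y k)) \<longlonglongrightarrow> (xs, zs, ys) \<and>
     (\<exists>C::real. \<forall>\<^sub>F K in sequentially.
        Min ((\<lambda>k. edist 0 (subdiff_Lagr Q p A l u (x k) (z k) (y k))) ` {1..K})
          \<le> ereal (C / sqrt (real K)))"

section \<open>Sanity check\<close>

lemma grad_eqI:
  assumes "GDERIV h x :> D"
  shows "grad h x = D"
  unfolding grad_def
proof (rule the_equality)
  fix D' assume "GDERIV h x :> D'"
  then have "(\<lambda>v. v \<bullet> D') = (\<lambda>v. v \<bullet> D)"
    using assms unfolding gderiv_def by (rule has_derivative_unique)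
  then have "(D' - D) \<bullet> D' = (D' - D) \<bullet> D"
    by (rule fun_cong)
  then have "(D' - D) \<bullet> (D' - D) = 0"
    by (simp add: inner_diff_right)
  then show "D' = D" by simp
qed (rule assms)

lemma grad_qp_f:
  assumes "transpose Q = Q"
  shows "grad (qp_f Q p) x = Q *v x + p"
proof (rule grad_eqI)
  have sym: "a \<bullet> (Q *v b) = b \<bullet> (Q *v a)" for a b
    by (metis assms dot_lmul_matrix inner_commute vector_transpose_matrix)
  have lin: "bounded_linear (\<lambda>v. Q *v v)"
    by (simp add: matrix_vector_mul_bounded_linear)
  have dQ: "((\<lambda>v. Q *v v) has_derivative (\<lambda>v. Q *v v)) (at x)"
    by (rule bounded_linear_imp_has_derivative[OF lin])
  have "(qp_f Q p has_derivative
      (\<lambda>h. 1/2 * (x \<bullet> (Q *v h) + h \<bullet> (Q *v x)) + p \<bullet> h)) (at x)"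
    unfolding qp_f_def[abs_def] by (auto intro!: derivative_eq_intros dQ)
  moreover have "(\<lambda>h. 1/2 * (x \<bullet> (Q *v h) + h \<bullet> (Q *v x)) + p \<bullet> h)
      = (\<lambda>h. h \<bullet> (Q *v x + p))"
    by (rule ext) (simp add: sym[of x] inner_add_right inner_commute[of p])
  ultimately show "GDERIV (qp_f Q p) x :> Q *v x + p"
    unfolding gderiv_def by simp
qed

end

theory Submission
  imports Defs
begin

text \<open>
  The proof combines a descent inequality for the energy with an error bound for the optimality
  system. Together they make the energy converge linearly and the path of the iterates have
  finite length, so the whole sequence converges.

  \<^emph>\<open>Descent.\<close> Only the multiplier update can increase the augmented Lagrangian, and it does so by
  \<open>\<rho> * (norm (r k))\<^sup>2\<close>, where \<open>r k\<close> is the primal residual. Since the inexact \<open>x\<close>-step determines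
  \<open>transpose A *v y\<close> up to its gradient error and \<open>transpose A\<close> is injective, this residual is
  controlled by the primal steps of the present and of the previous iteration
  (\<open>dual_step_bound\<close>). The terms of the previous iteration are the ones stored in the energy, and
  the three conditions on the parameters reserve a part of every decrease that is proportional to
  \<open>\<tau>\<close>; hence the energy decreases by a fixed multiple of the sum \<open>D n\<close> of squared step lengths
  (\<open>energy_descent\<close>).

  \<^emph>\<open>Error bound.\<close> The optimality conditions of the quadratic program form a finite union of systems
  of linear inequalities, one for every choice of possibly active bounds. By Hoffman's theorem
  (\<open>hoffman_error_bound\<close>, proved by Fourier-Motzkin elimination) a point with a small residual has
  an optimal primal-dual point at a distance of the order of that residual. The difference of
  the Lagrangian values at the two points pairs residuals with distances, so the value at the given
  point differs from the optimal value only by the order of the \<^emph>\<open>square\<close> of the residual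
  (\<open>lagrangian_error_bound\<close>). The residual of an iterate is in
  turn at most a multiple of the last step length, so that the energy exceeds the optimal value by
  at most \<open>C * D n\<close> (\<open>energy_near_optimal_value\<close>).

  Both inequalities together say that the gap between energy and optimal value shrinks by a
  constant factor per iteration; step lengths therefore decay geometrically and are summable
  (\<open>decrease_with_error_bound_summable_sqrt\<close>, \<open>finite_length\<close>). So the whole
  sequence of iterates converges, every limit point is its limit, and this limit is optimal
  because the energy converges to the optimal value. The distances to the subdifferentials are
  bounded by a multiple of the step length (\<open>stationarity_bound\<close>), which yields their
  convergence to zero and the rate.
\<close>

section \<open>Spectral bounds for symmetric matrices\<close>

lemma symmetric_inner_matrix:
  fixes M :: "real^'n^'n"
  assumes "transpose M = M"
  shows "v \<bullet> (M *v w) = (M *v v) \<bullet> w"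
  by (metis assms dot_lmul_matrix vector_transpose_matrix)

lemma transpose_inner:
  fixes A :: "real^'n^'m"
  shows "(transpose A *v w) \<bullet> v = w \<bullet> (A *v v)"
  by (simp add: dot_lmul_matrix)

text \<open>The form \<open>(v, w) \<mapsto> v \<bullet> (M *v w)\<close> is a possibly degenerate inner product; as usual, the polynomial
  \<open>t \<mapsto> (v + t w) \<bullet> M (v + t w)\<close> is nonnegative, so that its discriminant cannot be positive.\<close>
lemma psd_cauchy_schwarz:
  fixes M :: "real^'n^'n"
  assumes "psd M"
  shows "(v \<bullet> (M *v w))\<^sup>2 \<le> (v \<bullet> (M *v v)) * (w \<bullet> (M *v w))"
proof -
  have sym: "transpose M = M" and nn: "\<And>v. 0 \<le> v \<bullet> (M *v v)"
    using assms by (auto simp: psd_def)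
  let ?a = "v \<bullet> (M *v v)" and ?b = "v \<bullet> (M *v w)" and ?c = "w \<bullet> (M *v w)"
  have wv: "w \<bullet> (M *v v) = ?b"
    by (metis sym symmetric_inner_matrix inner_commute)
  \<comment> \<open>The cases below insert the minimiser \<open>t = - ?b / ?c\<close> of this polynomial or, if it is
    affine in \<open>t\<close>, a value of \<open>t\<close> that makes it equal to \<open>- 1\<close>.\<close>
  have quad: "0 \<le> ?a + 2 * t * ?b + t\<^sup>2 * ?c" for t
    using nn[of "v + t *\<^sub>R w"]
    by (simp add: matrix_vector_right_distrib matrix_vector_mult_scaleR inner_add_left
        inner_add_right wv power2_eq_square algebra_simps)
  show ?thesis
  proof (cases "?c = 0")
    case True
    have "?b = 0"
    proof (rule ccontr)
      assume "?b \<noteq> 0"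
      then show False
        using quad[of "- (?a + 1) / (2 * ?b)"] True by (simp add: field_simps)
    qed
    then show ?thesis using True by simp
  next
    case False
    then have "?c > 0" using nn[of w] by simp
    then show ?thesis using quad[of "- ?b / ?c"]
      by (simp add: field_simps power2_eq_square)
  qed
qed

lemma psd_null_vector:
  fixes M :: "real^'n^'n"
  assumes "psd M" "v \<bullet> (M *v v) = 0"
  shows "M *v v = 0"
  using psd_cauchy_schwarz[OF assms(1), of "M *v v" v] assms(2) by simp

text \<open>A minimiser of the Rayleigh quotient on the unit sphere is an eigenvector: subtracting the
  minimum \<open>c\<close> times the identity gives a positive semidefinite matrix whose quadratic form
  vanishes at the minimiser, which is then a null vector of that matrix.\<close>
lemma symmetric_least_eigenvalue:
  fixes M :: "real^'n^'n"
  assumes sym: "transpose M = M"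
  obtains c v where "norm v = 1" "M *v v = c *\<^sub>R v" "\<And>w. c * (norm w)\<^sup>2 \<le> w \<bullet> (M *v w)"
proof -
  let ?S = "sphere (0 :: real^'n) 1"
  have ne: "?S \<noteq> {}"
    by (metis dist_0_norm empty_iff mem_sphere norm_axis_1)
  have "continuous_on ?S (\<lambda>w. w \<bullet> (M *v w))"
    by (intro continuous_intros)
  then obtain v where v: "v \<in> ?S" and min: "\<And>w. w \<in> ?S \<Longrightarrow> v \<bullet> (M *v v) \<le> w \<bullet> (M *v w)"
    using continuous_attains_inf[OF compact_sphere ne] by blast
  define c where "c = v \<bullet> (M *v v)"
  have bound: "c * (norm w)\<^sup>2 \<le> w \<bullet> (M *v w)" for w
  proof (cases "w = 0")
    case False
    have "c \<le> (w /\<^sub>R norm w) \<bullet> (M *v (w /\<^sub>R norm w))"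
      unfolding c_def using False by (intro min) simp
    also have "\<dots> = (w \<bullet> (M *v w)) / (norm w)\<^sup>2"
      by (simp add: matrix_vector_mult_scaleR power2_eq_square field_simps)
    finally show ?thesis using False by (simp add: field_simps)
  qed simp
  \<comment> \<open>Positive semidefinite by the Rayleigh bound, and with vanishing form at \<open>v\<close>.\<close>
  define N where "N = M - c *\<^sub>R mat 1"
  have N: "N *v w = M *v w - c *\<^sub>R w" for w
    by (simp add: N_def matrix_vector_mult_diff_rdistrib scaleR_matrix_vector_assoc[symmetric])
  have "transpose N = N"
    using sym by (simp add: N_def transpose_def vec_eq_iff mat_def)
  then have "psd N"
    using bound by (simp add: psd_def N inner_diff_right power2_norm_eq_inner)
  moreover have "v \<bullet> (N *v v) = 0"
    using v by (simp add: N inner_diff_right c_def norm_eq_1)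
  ultimately have "N *v v = 0" by (rule psd_null_vector)
  then show ?thesis using that[of v c] v bound by (simp add: N)
qed

lemma symmetric_greatest_eigenvalue:
  fixes M :: "real^'n^'n"
  assumes sym: "transpose M = M"
  obtains c v where "norm v = 1" "M *v v = c *\<^sub>R v" "\<And>w. w \<bullet> (M *v w) \<le> c * (norm w)\<^sup>2"
proof -
  have neg: "(- M) *v w = - (M *v w)" for w
    by (metis diff_0 matrix_vector_mult_0 matrix_vector_mult_diff_rdistrib)
  have "transpose (- M) = - M"
    using sym by (simp add: transpose_def vec_eq_iff)
  then obtain c v where cv: "norm v = 1" "(- M) *v v = c *\<^sub>R v"
      "\<And>w. c * (norm w)\<^sup>2 \<le> w \<bullet> ((- M) *v w)"
    using symmetric_least_eigenvalue by blast
  show ?thesis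
  proof (rule that[of v "- c"])
    show "M *v v = - c *\<^sub>R v" using cv(2) unfolding neg by (metis minus_equation_iff scaleR_minus_left)
    show "w \<bullet> (M *v w) \<le> - c * (norm w)\<^sup>2" for w
      using cv(3)[of w] unfolding neg by simp
  qed (rule cv(1))
qed

text \<open>Eigenvectors of distinct eigenvalues are orthogonal, hence independent. Finiteness is what makes
  the \<open>Max\<close> and \<open>Min\<close> in \<open>sigma_max\<close> and \<open>sigma_min\<close> meaningful.\<close>
lemma finite_eigenvalues_symmetric:
  fixes M :: "real^'n^'n"
  assumes sym: "transpose M = M"
  shows "finite (eigenvalues M)"
proof -
  have "\<exists>v. v \<noteq> 0 \<and> M *v v = c *\<^sub>R v" if "c \<in> eigenvalues M" for c
    using that by (auto simp: eigenvalues_def)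
  then obtain e where e: "\<And>c. c \<in> eigenvalues M \<Longrightarrow> e c \<noteq> 0 \<and> M *v e c = c *\<^sub>R e c"
    by metis
  have orth: "e c \<bullet> e d = 0" if "c \<in> eigenvalues M" "d \<in> eigenvalues M" "c \<noteq> d" for c d
  proof -
    have "d * (e c \<bullet> e d) = c * (e c \<bullet> e d)"
      using symmetric_inner_matrix[OF sym, of "e c" "e d"] e[OF that(1)] e[OF that(2)] by simp
    then show ?thesis using that(3) by simp
  qed
  have inj: "inj_on e (eigenvalues M)"
  proof (rule inj_onI, rule ccontr)
    fix c d assume "c \<in> eigenvalues M" "d \<in> eigenvalues M" "e c = e d" "c \<noteq> d"
    then show False using orth[of c d] e[of c] by simp
  qed
  have "pairwise orthogonal (e ` eigenvalues M)"
    unfolding pairwise_def orthogonal_def using orth by auto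
  moreover have "0 \<notin> e ` eigenvalues M" using e by force
  ultimately have "independent (e ` eigenvalues M)" by (rule pairwise_orthogonal_independent)
  then have "finite (e ` eigenvalues M)" by (rule finiteI_independent)
  then show ?thesis using inj by (rule finite_imageD)
qed

lemma sigma_max_rayleigh:
  fixes M :: "real^'n^'n"
  assumes sym: "transpose M = M"
  shows "w \<bullet> (M *v w) \<le> sigma_max M * (norm w)\<^sup>2"
proof -
  obtain c v where cv: "norm v = 1" "M *v v = c *\<^sub>R v" "\<And>w. w \<bullet> (M *v w) \<le> c * (norm w)\<^sup>2"
    using symmetric_greatest_eigenvalue[OF sym] by blast
  have "v \<noteq> 0" using cv(1) by auto
  then have "c \<in> eigenvalues M" using cv(2) unfolding eigenvalues_def by blast
  then have "c \<le> sigma_max M"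
    unfolding sigma_max_def by (rule Max_ge[OF finite_eigenvalues_symmetric[OF sym]])
  then show ?thesis using cv(3)[of w] mult_right_mono[of c "sigma_max M" "(norm w)\<^sup>2"] by simp
qed

text \<open>Apply the Cauchy-Schwarz inequality of the form given by \<open>M\<close> to the vectors \<open>M *v v\<close> and \<open>v\<close>, and
  bound both quadratic forms by the Rayleigh quotient.\<close>
lemma norm_le_sigma_max:
  fixes M :: "real^'n^'n"
  assumes "psd M"
  shows "norm (M *v v) \<le> sigma_max M * norm v"
proof (cases "M *v v = 0")
  case True
  have "0 \<le> v \<bullet> (M *v v)" using assms by (simp add: psd_def)
  also have "\<dots> \<le> sigma_max M * (norm v)\<^sup>2"
    by (rule sigma_max_rayleigh) (use assms in \<open>simp add: psd_def\<close>)
  finally have "0 \<le> (sigma_max M * norm v) * norm v" by (simp add: power2_eq_square mult.assoc)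
  then have "0 \<le> sigma_max M * norm v" by (cases "v = 0") (auto simp: zero_le_mult_iff)
  then show ?thesis using True by simp
next
  case False
  have sym: "transpose M = M" and nn: "\<And>v. 0 \<le> v \<bullet> (M *v v)"
    using assms by (auto simp: psd_def)
  let ?w = "M *v v"
  have ray: "x \<bullet> (M *v x) \<le> sigma_max M * (norm x)\<^sup>2" for x by (rule sigma_max_rayleigh[OF sym])
  have "?w \<bullet> (M *v v) = (norm ?w)\<^sup>2" by (simp add: power2_norm_eq_inner)
  then have "((norm ?w)\<^sup>2)\<^sup>2 \<le> (?w \<bullet> (M *v ?w)) * (v \<bullet> (M *v v))"
    using psd_cauchy_schwarz[OF assms, of ?w v] by simp
  also have "\<dots> \<le> (sigma_max M * (norm ?w)\<^sup>2) * (sigma_max M * (norm v)\<^sup>2)"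
    by (intro mult_mono ray nn) (use ray[of ?w] nn[of ?w] in linarith)
  also have "\<dots> = (sigma_max M * norm v)\<^sup>2 * (norm ?w)\<^sup>2"
    by (simp add: power2_eq_square algebra_simps)
  finally have "(norm ?w)\<^sup>2 * (norm ?w)\<^sup>2 \<le> (sigma_max M * norm v)\<^sup>2 * (norm ?w)\<^sup>2"
    by (simp add: power2_eq_square)
  then have le: "(norm ?w)\<^sup>2 \<le> (sigma_max M * norm v)\<^sup>2"
    by (rule mult_right_le_imp_le) (use False in simp)
  have "0 < sigma_max M * (norm ?w)\<^sup>2 \<or> sigma_max M * (norm ?w)\<^sup>2 = 0"
    using ray[of ?w] nn[of ?w] by linarith
  then have "0 \<le> sigma_max M" using False by (auto simp: zero_less_mult_iff)
  then show ?thesis using le by (intro power2_le_imp_le[OF le]) simp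
qed

lemma symmetric_gram: "transpose (transpose A ** A) = transpose A ** (A :: real^'n^'m)"
  by (simp add: matrix_transpose_mul transpose_transpose)

text \<open>The transpose has the same operator norm as \<open>A\<close> itself, and the Rayleigh bound of
  \<open>transpose A ** A\<close> controls the latter.\<close>
lemma norm_transpose_le_sigma_max:
  fixes A :: "real^'n^'m"
  shows "(norm (transpose A *v w))\<^sup>2 \<le> sigma_max (transpose A ** A) * (norm w)\<^sup>2"
proof (cases "transpose A *v w = 0")
  let ?s = "sigma_max (transpose A ** A)"
  have img: "(norm (A *v v))\<^sup>2 \<le> ?s * (norm v)\<^sup>2" for v
    using sigma_max_rayleigh[OF symmetric_gram, of v A]
    by (metis inner_commute matrix_vector_mul_assoc power2_norm_eq_inner transpose_inner)
  have s0: "0 \<le> ?s"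
    using img[of "axis undefined 1"] zero_le_power2 by (metis (no_types, lifting) mult.right_neutral norm_axis_1 one_power2 order_trans)
  {
    case True
    then show ?thesis using s0 by simp
  next
    case False
    let ?v = "transpose A *v w"
    have "(norm ?v)\<^sup>2 = w \<bullet> (A *v ?v)"
      by (metis power2_norm_eq_inner transpose_inner)
    also have "\<dots> \<le> norm w * norm (A *v ?v)" by (rule norm_cauchy_schwarz)
    finally have "((norm ?v)\<^sup>2)\<^sup>2 \<le> (norm w * norm (A *v ?v))\<^sup>2"
      by (intro power_mono) auto
    also have "\<dots> \<le> (norm w)\<^sup>2 * (?s * (norm ?v)\<^sup>2)"
      unfolding power_mult_distrib by (intro mult_left_mono img) simp
    finally have "(norm ?v)\<^sup>2 * (norm ?v)\<^sup>2 \<le> (?s * (norm w)\<^sup>2) * (norm ?v)\<^sup>2"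
      by (simp add: power2_eq_square algebra_simps)
    then show ?thesis by (rule mult_right_le_imp_le) (use False in simp)
  }
qed

text \<open>For surjective \<open>A\<close> the transpose is injective, so the least eigenvalue of \<open>A ** transpose A\<close> is
  positive. It is also an eigenvalue of \<open>transpose A ** A\<close>, since \<open>transpose A\<close> maps the
  eigenvectors of the one product to those of the other; hence it is at least \<open>sigma_min\<close>.\<close>
lemma sigma_min_surjective:
  fixes A :: "real^'n^'m"
  assumes surj: "\<forall>w. w \<in> range (\<lambda>v. A *v v)"
  shows "0 < sigma_min (transpose A ** A)"
    and "sigma_min (transpose A ** A) * (norm w)\<^sup>2 \<le> (norm (transpose A *v w))\<^sup>2"
proof -
  let ?P = "{c \<in> eigenvalues (transpose A ** A). 0 < c}"
  have outer: "w \<bullet> ((A ** transpose A) *v w) = (norm (transpose A *v w))\<^sup>2" for w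
    by (metis matrix_vector_mul_assoc power2_norm_eq_inner transpose_inner)
  have inj: "transpose A *v w \<noteq> 0" if "w \<noteq> 0" for w
  proof
    assume "transpose A *v w = 0"
    moreover obtain v where "w = A *v v" using surj by blast
    ultimately have "w \<bullet> w = 0" using transpose_inner[of A w v] by simp
    then show False using that by simp
  qed
  have "transpose (A ** transpose A) = A ** transpose A"
    by (simp add: matrix_transpose_mul transpose_transpose)
  then obtain c e where e: "norm e = 1" "(A ** transpose A) *v e = c *\<^sub>R e"
      "\<And>w. c * (norm w)\<^sup>2 \<le> w \<bullet> ((A ** transpose A) *v w)"
    using symmetric_least_eigenvalue by blast
  have "e \<noteq> 0" using e(1) by auto
  have "c = e \<bullet> ((A ** transpose A) *v e)" using e(1,2) by (simp add: norm_eq_1)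
  then have "0 < c" using inj[OF \<open>e \<noteq> 0\<close>] unfolding outer by simp
  moreover have "(transpose A ** A) *v (transpose A *v e) = c *\<^sub>R (transpose A *v e)"
    by (metis e(2) matrix_vector_mul_assoc matrix_vector_mult_scaleR)
  ultimately have c: "c \<in> ?P"
    using inj[OF \<open>e \<noteq> 0\<close>] by (auto simp: eigenvalues_def)
  have fin: "finite ?P"
    using finite_eigenvalues_symmetric[OF symmetric_gram, of A] by simp
  have "sigma_min (transpose A ** A) \<in> ?P"
    unfolding sigma_min_def using fin c by (intro Min_in) auto
  then show pos: "0 < sigma_min (transpose A ** A)" by simp
  have "sigma_min (transpose A ** A) \<le> c"
    unfolding sigma_min_def using fin c by (intro Min_le)
  then have "sigma_min (transpose A ** A) * (norm w)\<^sup>2 \<le> c * (norm w)\<^sup>2"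
    by (intro mult_right_mono) auto
  then show "sigma_min (transpose A ** A) * (norm w)\<^sup>2 \<le> (norm (transpose A *v w))\<^sup>2"
    using e(3)[of w] unfolding outer by linarith
qed

lemma psd_scaled_identity: "psd (c *\<^sub>R (mat 1 :: real^'n^'n)) \<longleftrightarrow> 0 \<le> c"
proof
  assume "psd (c *\<^sub>R (mat 1 :: real^'n^'n))"
  then have "0 \<le> axis undefined 1 \<bullet> ((c *\<^sub>R (mat 1 :: real^'n^'n)) *v axis undefined 1)"
    by (simp add: psd_def)
  then show "0 \<le> c" by (simp add: scaleR_matrix_vector_assoc[symmetric])
next
  assume "0 \<le> c"
  then show "psd (c *\<^sub>R (mat 1 :: real^'n^'n))"
    by (simp add: psd_def transpose_def vec_eq_iff scaleR_matrix_vector_assoc[symmetric])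
      (simp add: mat_def)
qed

section \<open>Hoffman error bound for linear inequalities\<close>

text \<open>Only linearity of \<open>h\<close> after subtracting \<open>h 0\<close> is recorded; the elimination below uses the increment
  \<open>h e - h 0\<close> as the slope of \<open>h\<close> in the direction \<open>e\<close>.\<close>
definition affine_function :: "('a::real_vector \<Rightarrow> real) \<Rightarrow> bool" where
  "affine_function h \<longleftrightarrow> linear (\<lambda>v. h v - h 0)"

lemma affine_function_add: 
  assumes "affine_function f" "affine_function g"
  shows "affine_function (\<lambda>w. f w + g w)"
  using linear_compose_add[OF assms[unfolded affine_function_def]]
  by (simp add: affine_function_def algebra_simps)

lemma affine_function_divide: 
  assumes "affine_function f"
  shows "affine_function (\<lambda>w. f w / (c::real))"
  using linear_compose_scale_right[OF assms[unfolded affine_function_def], of "inverse c"]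
  by (simp add: affine_function_def diff_divide_distrib divide_inverse algebra_simps)

lemma affine_function_shift:
  assumes "affine_function h"
  shows "h (w + t *\<^sub>R v) = h w + t * (h v - h 0)"
  using linear_add[OF assms[unfolded affine_function_def], of w "t *\<^sub>R v"]
    linear_scale[OF assms[unfolded affine_function_def], of t v] by simp

lemma affine_function_Lipschitz:
  fixes h :: "'a::euclidean_space \<Rightarrow> real"
  assumes "affine_function h"
  obtains K where "K \<ge> 0" "\<And>v w. \<bar>h v - h w\<bar> \<le> K * norm (v - w)"
proof -
  have lin: "linear (\<lambda>v. h v - h 0)" using assms by (simp add: affine_function_def)
  then obtain K where K: "K > 0" "\<And>v. norm (h v - h 0) \<le> K * norm v"
    using linear_bounded_pos by blast
  have "\<bar>h v - h w\<bar> \<le> K * norm (v - w)" for v w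
    using K(2)[of "v - w"] linear_diff[OF lin, of v w] by simp
  then show ?thesis using K(1) that[of K] by simp
qed

lemma finite_uniform_bound:
  assumes "finite H" "\<forall>h\<in>H. \<exists>K::real. \<forall>K'\<ge>K. P h K'"
  shows "\<exists>K\<ge>0. \<forall>h\<in>H. P h K"
proof -
  obtain b where b: "\<forall>h\<in>H. \<forall>K'\<ge>b h. P h K'" using assms(2) by metis
  have "\<forall>h\<in>H. b h \<le> Max (insert 0 (b ` H))" using assms(1) by simp
  moreover have "0 \<le> Max (insert 0 (b ` H))" using assms(1) by simp
  ultimately show ?thesis using b by blast
qed

text \<open>The choice of the eliminated coordinate, as an offset \<open>t\<close>: \<open>U\<close> and \<open>V\<close> are its upper and lower
  bounds. Offset \<open>0\<close> nearly satisfies them, so one of size at most \<open>M\<close> satisfies them exactly.\<close>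
lemma interval_point_near_zero:
  fixes U V :: "real set"
  assumes "finite V" and sep: "\<And>u v. u \<in> U \<Longrightarrow> v \<in> V \<Longrightarrow> v \<le> u"
    and "\<And>u. u \<in> U \<Longrightarrow> - M \<le> u" and "\<And>v. v \<in> V \<Longrightarrow> v \<le> M" and "0 \<le> M"
  obtains t where "\<bar>t\<bar> \<le> M" "\<And>u. u \<in> U \<Longrightarrow> t \<le> u" "\<And>v. v \<in> V \<Longrightarrow> v \<le> t"
proof -
  let ?t = "Max (insert (- M) V)"
  have "\<bar>?t\<bar> \<le> M"
  proof -
    have "?t \<le> M" using assms by (auto intro!: Max.boundedI)
    moreover have "- M \<le> ?t" using assms by simp
    ultimately show ?thesis by linarith
  qed
  moreover have "?t \<le> u" if "u \<in> U" for u using that assms by (intro Max.boundedI) auto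
  moreover have "v \<le> ?t" if "v \<in> V" for v using that assms by simp
  ultimately show ?thesis using that by blast
qed

text \<open>Fourier-Motzkin elimination, by induction on the set \<open>B\<close> of coordinates on which the constraints
  depend. To eliminate \<open>e\<close>, every constraint with positive slope in the direction \<open>e\<close> is combined with
  every constraint with negative slope so that \<open>e\<close> cancels. A point with violation \<open>r\<close> violates the
  eliminated system by at most a multiple of \<open>r\<close>, the induction hypothesis moves it to a solution
  of that system, and a further step along \<open>e\<close>, again of the order of \<open>r\<close>, solves the original one.

  The threshold \<open>\<epsilon>\<close> covers systems without a solution: these have a positive least violation, so
  the conclusion includes solvability whenever some point has violation below \<open>\<epsilon>\<close>.\<close>
lemma hoffman_coordinates:
  fixes H :: "('a::euclidean_space \<Rightarrow> real) set"
  assumes "finite B" "B \<subseteq> Basis" "finite H" "\<forall>h\<in>H. affine_function h"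
    "\<forall>h\<in>H. \<forall>d\<in>Basis - B. h d = h 0"
  shows "\<exists>c\<ge>0. \<exists>\<epsilon>>0. \<forall>w r. 0 \<le> r \<and> r < \<epsilon> \<and> (\<forall>h\<in>H. h w \<le> r) \<longrightarrow>
           (\<exists>w'. (\<forall>h\<in>H. h w' \<le> 0) \<and> norm (w - w') \<le> c * r)"
  using assms
proof (induction B arbitrary: H rule: finite_induct)
  case empty
  have const: "h w = h 0" if "h \<in> H" for h w
  proof -
    have lin: "linear (\<lambda>v. h v - h 0)" using that empty by (simp add: affine_function_def)
    have "(\<lambda>v. h v - h 0) = (\<lambda>_. 0)"
      by (rule linear_eq_stdbasis[OF lin module_hom_zero]) (use that empty in auto)
    then show ?thesis by (metis eq_iff_diff_eq_0)
  qed
  \<comment> \<open>Without coordinates every constraint is constant, so a violation below the least positive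
    constant is no violation.\<close>
  define E where "E = {h 0 |h. h \<in> H \<and> h 0 > 0}"
  have "finite E"
    unfolding E_def using \<open>finite H\<close> by simp
  define \<epsilon> where "\<epsilon> = Min (insert 1 E)"
  have "\<epsilon> > 0" unfolding \<epsilon>_def using \<open>finite E\<close> by (auto simp: E_def)
  have "\<forall>h\<in>H. h w \<le> 0" if "r < \<epsilon>" "\<forall>h\<in>H. h w \<le> r" for w r
  proof (rule ballI, rule ccontr)
    fix h assume h: "h \<in> H" "\<not> h w \<le> 0"
    then have "h 0 \<in> E" using const[OF h(1), of w] by (auto simp: E_def)
    then have "\<epsilon> \<le> h 0" unfolding \<epsilon>_def using \<open>finite E\<close> by simp
    then show False using that h const[OF h(1), of w] by force
  qed
  then have "\<forall>w r. 0 \<le> r \<and> r < \<epsilon> \<and> (\<forall>h\<in>H. h w \<le> r) \<longrightarrow>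
           (\<exists>w'. (\<forall>h\<in>H. h w' \<le> 0) \<and> norm (w - w') \<le> 0 * r)"
    by (metis diff_self mult_zero_left norm_zero order_refl)
  then show ?case using \<open>\<epsilon> > 0\<close> by (metis order_refl)
next
  case (insert e B)
  have e: "e \<in> Basis" "norm e = 1" using insert.prems by auto
  define s where "s h = h e - h 0" for h :: "'a \<Rightarrow> real"
  define Z where "Z = {h \<in> H. s h = 0}"
  define P where "P = {h \<in> H. s h > 0}"
  define N where "N = {h \<in> H. s h < 0}"
  \<comment> \<open>Scaled to slopes \<open>1\<close> and \<open>- 1\<close>, so that the sum has slope \<open>0\<close>.\<close>
  define comb where "comb p q = (\<lambda>w. p w / s p + q w / (- s q))" for p q
  define H' where "H' = Z \<union> (\<lambda>(p, q). comb p q) ` (P \<times> N)"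
  have H: "H = Z \<union> P \<union> N" and fin: "finite Z" "finite P" "finite N"
    using \<open>finite H\<close> by (auto simp: Z_def P_def N_def)
  have aff: "affine_function h" if "h \<in> H" for h using that insert.prems by blast
  have IH: "\<exists>c\<ge>0. \<exists>\<epsilon>>0. \<forall>w r. 0 \<le> r \<and> r < \<epsilon> \<and> (\<forall>h\<in>H'. h w \<le> r) \<longrightarrow>
           (\<exists>w'. (\<forall>h\<in>H'. h w' \<le> 0) \<and> norm (w - w') \<le> c * r)"
  proof (rule insert.IH)
    show "B \<subseteq> Basis" using insert.prems by auto
    show "finite H'" using fin by (simp add: H'_def)
    have "affine_function h" if h: "h \<in> H'" for h
    proof (cases "h \<in> Z")
      case True
      then show ?thesis by (intro aff) (simp add: Z_def)
    next
      case False
      then obtain p q where pq: "p \<in> P" "q \<in> N" "h = comb p q"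
        using h by (auto simp: H'_def)
      have "affine_function p" "affine_function q"
        using pq(1,2) by (auto simp: P_def N_def intro: aff)
      then show ?thesis
        unfolding pq(3) comb_def by (intro affine_function_add affine_function_divide)
    qed
    then show "\<forall>h\<in>H'. affine_function h" by blast
    show "\<forall>h\<in>H'. \<forall>d\<in>Basis - B. h d = h 0"
    proof (intro ballI)
      fix h d assume h: "h \<in> H'" and d: "d \<in> Basis - B"
      have flat: "k d = k 0" if "k \<in> H" "d \<noteq> e" for k
        using that d insert.prems by blast
      show "h d = h 0"
      proof (cases "h \<in> Z")
        case True
        then show ?thesis using flat[of h] by (cases "d = e") (auto simp: Z_def s_def)
      next
        case False
        then obtain p q where pq: "p \<in> P" "q \<in> N" "h = comb p q"
          using h by (auto simp: H'_def)
        show ?thesis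
        proof (cases "d = e")
          case True
          have "p e = p 0 + s p" "q e = q 0 + s q" "s p \<noteq> 0" "s q \<noteq> 0"
            using pq by (auto simp: P_def N_def s_def)
          then show ?thesis unfolding pq(3) comb_def True by (simp add: add_divide_distrib)
        next
          case False
          then show ?thesis using flat[of p] flat[of q] pq by (simp add: comb_def P_def N_def)
        qed
      qed
    qed
  qed
  then obtain c \<epsilon> where c: "c \<ge> 0" and \<epsilon>: "\<epsilon> > 0"
    and near: "\<And>w r. 0 \<le> r \<Longrightarrow> r < \<epsilon> \<Longrightarrow> (\<forall>h\<in>H'. h w \<le> r) \<Longrightarrow>
           (\<exists>w'. (\<forall>h\<in>H'. h w' \<le> 0) \<and> norm (w - w') \<le> c * r)"
    by blast
  have "\<exists>L\<ge>0. \<forall>h\<in>H. \<forall>v w. \<bar>h v - h w\<bar> \<le> L * norm (v - w)"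
  proof (rule finite_uniform_bound[OF \<open>finite H\<close>], rule ballI)
    fix h assume "h \<in> H"
    then obtain L where L: "\<And>v w. \<bar>h v - h w\<bar> \<le> L * norm (v - w)"
      using affine_function_Lipschitz[OF aff[OF \<open>h \<in> H\<close>]] by metis
    have "\<bar>h v - h w\<bar> \<le> L' * norm (v - w)" if "L \<le> L'" for L' v w
      using L[of v w] mult_right_mono[OF that norm_ge_zero[of "v - w"]] by linarith
    then show "\<exists>L. \<forall>L'\<ge>L. \<forall>v w. \<bar>h v - h w\<bar> \<le> L' * norm (v - w)" by blast
  qed
  then obtain L where L: "L \<ge> 0" "\<forall>h\<in>H. \<forall>v w. \<bar>h v - h w\<bar> \<le> L * norm (v - w)"
    by blast
  have "\<exists>K\<ge>0. \<forall>h\<in>H. 1 / \<bar>s h\<bar> \<le> K"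
    by (rule finite_uniform_bound[OF \<open>finite H\<close>]) blast
  then obtain K where K: "K \<ge> 0" "\<forall>h\<in>H. 1 / \<bar>s h\<bar> \<le> K" by blast
  \<comment> \<open>A point with violation \<open>r\<close> of \<open>H\<close> has at most the violation \<open>K1 * r\<close> of \<open>H'\<close>, and \<open>M * r\<close> will bound the step
    along \<open>e\<close>.\<close>
  define K1 where "K1 = 1 + 2 * K"
  have K1: "K1 \<ge> 1" using K by (simp add: K1_def)
  define M where "M = K * (1 + L * c * K1)"
  have M: "M \<ge> 0" using K L c K1 by (simp add: M_def)
  show ?case
  proof (rule exI[of _ "c * K1 + M"], rule conjI, goal_cases)
    case 1
    show ?case using c K1 M by simp
  next
    case 2
    show ?case
    proof (rule exI[of _ "\<epsilon> / K1"], intro conjI allI impI; (elim conjE)?)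
      show "0 < \<epsilon> / K1" using K1 \<epsilon> by auto
      fix w r assume r: "0 \<le> r" "r < \<epsilon> / K1" and viol: "\<forall>h\<in>H. h w \<le> r"
      have scaled: "h v / \<bar>s h\<bar> \<le> a * K" if "h \<in> H" "h v \<le> a" "0 \<le> a" for h v a
      proof -
        have "h v / \<bar>s h\<bar> \<le> a * (1 / \<bar>s h\<bar>)" using that by (simp add: divide_right_mono)
        also have "\<dots> \<le> a * K" using K that by (intro mult_left_mono) auto
        finally show ?thesis .
      qed
      have "\<forall>h\<in>H'. h w \<le> K1 * r"
      proof
        fix h assume "h \<in> H'"
        then consider "h \<in> Z" | p q where "p \<in> P" "q \<in> N" "h = comb p q"
          by (auto simp: H'_def)
        then show "h w \<le> K1 * r"
        proof cases
          case 1
          then have "h w \<le> r" using viol H by blast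
          also have "\<dots> \<le> K1 * r" using K1 r by (simp add: mult_le_cancel_right1)
          finally show ?thesis .
        next
          case 2
          have "p w / \<bar>s p\<bar> \<le> r * K" "q w / \<bar>s q\<bar> \<le> r * K"
            using 2 viol r H by (auto intro!: scaled)
          moreover have "h w = p w / \<bar>s p\<bar> + q w / \<bar>s q\<bar>"
            using 2 by (simp add: comb_def P_def N_def)
          ultimately show ?thesis using r by (simp add: K1_def algebra_simps)
        qed
      qed
      moreover have "0 \<le> K1 * r" using r K1 by simp
      moreover have "K1 * r < \<epsilon>" using r(2) K1 by (simp add: pos_less_divide_eq mult.commute)
      ultimately obtain w1 where w1: "\<forall>h\<in>H'. h w1 \<le> 0" "norm (w - w1) \<le> c * (K1 * r)"
        using near by blast
      have at_w1: "h w1 / \<bar>s h\<bar> \<le> M * r" if "h \<in> H" for h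
      proof -
        have "h w1 \<le> h w + L * norm (w1 - w)" using L(2)[rule_format, OF that, of w1 w] by linarith
        also have "\<dots> \<le> r + L * (c * (K1 * r))"
        proof (intro add_mono mult_left_mono)
          show "h w \<le> r" using viol that by blast
          show "norm (w1 - w) \<le> c * (K1 * r)" using w1(2) by (simp add: norm_minus_commute)
        qed (rule L(1))
        also have "\<dots> = (1 + L * c * K1) * r" by (simp add: algebra_simps)
        finally have "h w1 / \<bar>s h\<bar> \<le> (1 + L * c * K1) * r * K"
        proof (rule scaled[OF that])
          show "0 \<le> (1 + L * c * K1) * r" using r(1) L(1) c K1 by simp
        qed
        then show ?thesis by (simp add: M_def mult_ac)
      qed
      \<comment> \<open>Move along \<open>e\<close> only: the constraints with positive slope bound the step \<open>t\<close> from above,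
        those with negative slope from below, and the combined constraints say that these bounds
        are compatible.\<close>
      obtain t where t: "\<bar>t\<bar> \<le> M * r" "\<And>u. u \<in> (\<lambda>p. - p w1 / s p) ` P \<Longrightarrow> t \<le> u"
          "\<And>v. v \<in> (\<lambda>q. q w1 / (- s q)) ` N \<Longrightarrow> v \<le> t"
      proof (rule interval_point_near_zero)
        show "finite ((\<lambda>q. q w1 / (- s q)) ` N)" using fin by simp
        show "0 \<le> M * r" using M r by simp
        show "- (M * r) \<le> u" if u: "u \<in> (\<lambda>p. - p w1 / s p) ` P" for u
        proof -
          obtain p where "p \<in> H" "s p > 0" "u = - p w1 / s p" using u by (auto simp: P_def)
          then show ?thesis using at_w1[of p] by simp
        qed
        show "v \<le> M * r" if v: "v \<in> (\<lambda>q. q w1 / (- s q)) ` N" for v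
        proof -
          obtain q where "q \<in> H" "s q < 0" "v = q w1 / (- s q)" using v by (auto simp: N_def)
          then show ?thesis using at_w1[of q] by simp
        qed
        show "v \<le> u" if uv: "u \<in> (\<lambda>p. - p w1 / s p) ` P" "v \<in> (\<lambda>q. q w1 / (- s q)) ` N" for u v
        proof -
          obtain p q where pq: "p \<in> P" "q \<in> N" "u = - p w1 / s p" "v = q w1 / (- s q)"
            using uv by blast
          then have "comb p q \<in> H'" by (auto simp: H'_def)
          then have "comb p q w1 \<le> 0" using w1 by blast
          then show ?thesis using pq by (simp add: comb_def)
        qed
      next
        fix t assume "\<bar>t\<bar> \<le> M * r" "\<And>u. u \<in> (\<lambda>p. - p w1 / s p) ` P \<Longrightarrow> t \<le> u"
          "\<And>v. v \<in> (\<lambda>q. q w1 / (- s q)) ` N \<Longrightarrow> v \<le> t"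
        then show thesis by (rule that)
      qed
      have "h (w1 + t *\<^sub>R e) \<le> 0" if h: "h \<in> H" for h
      proof -
        have shift: "h (w1 + t *\<^sub>R e) = h w1 + t * s h"
          unfolding s_def by (rule affine_function_shift[OF aff[OF h]])
        consider "h \<in> Z" | "h \<in> P" | "h \<in> N" using h H by blast
        then show ?thesis
        proof cases
          case 1
          then show ?thesis using w1 shift by (auto simp: H'_def Z_def)
        next
          case 2
          then have "t \<le> - h w1 / s h" "0 < s h" using t(2) by (auto simp: P_def)
          then show ?thesis using shift by (simp add: field_simps)
        next
          case 3
          then have "h w1 / (- s h) \<le> t" "s h < 0" using t(3) by (blast, simp add: N_def)
          then show ?thesis using shift by (simp add: field_simps)
        qed
      qed
      moreover have "norm (w - (w1 + t *\<^sub>R e)) \<le> (c * K1 + M) * r"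
      proof -
        have "norm (w - (w1 + t *\<^sub>R e)) \<le> norm (w - w1) + \<bar>t\<bar> * norm e"
          by (metis diff_diff_add norm_scaleR norm_triangle_ineq4)
        also have "\<dots> \<le> c * (K1 * r) + M * r" using w1 t(1) e(2) by simp
        finally show ?thesis by (simp add: algebra_simps)
      qed
      ultimately show "\<exists>w'. (\<forall>h\<in>H. h w' \<le> 0) \<and> norm (w - w') \<le> (c * K1 + M) * r"
        by blast
    qed
  qed
qed

text \<open>The error constant and the threshold are merged into one number that may be enlarged, which is the
  form in which finitely many systems can be treated at once.\<close>
lemma hoffman_error_bound:
  fixes H :: "('a::euclidean_space \<Rightarrow> real) set"
  assumes "finite H" "\<forall>h\<in>H. affine_function h"
  shows "\<exists>K. \<forall>K'\<ge>K. \<forall>w r. 0 \<le> r \<and> K' * r < 1 \<and> (\<forall>h\<in>H. h w \<le> r) \<longrightarrow>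
       (\<exists>w'. (\<forall>h\<in>H. h w' \<le> 0) \<and> norm (w - w') \<le> K' * r)"
proof -
  obtain c \<epsilon> where c: "c \<ge> 0" and \<epsilon>: "\<epsilon> > 0"
    and near: "\<And>w r. 0 \<le> r \<and> r < \<epsilon> \<and> (\<forall>h\<in>H. h w \<le> r) \<Longrightarrow>
       \<exists>w'. (\<forall>h\<in>H. h w' \<le> 0) \<and> norm (w - w') \<le> c * r"
    using hoffman_coordinates[OF finite_Basis order_refl assms] by blast
  show ?thesis
  proof (rule exI[of _ "max c (1 / \<epsilon>)"], intro allI impI, elim conjE)
    fix K' w r assume K': "max c (1 / \<epsilon>) \<le> K'" and r: "0 \<le> r" "K' * r < 1" "\<forall>h\<in>H. h w \<le> r"
    have "1 / \<epsilon> * r \<le> K' * r" using K' r by (intro mult_right_mono) auto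
    also note r(2)
    finally have "r < \<epsilon>" using \<epsilon> by (simp add: field_simps)
    with near[OF conjI[OF r(1) conjI[OF _ r(3)]]]
    obtain w' where w': "\<forall>h\<in>H. h w' \<le> 0" "norm (w - w') \<le> c * r" by auto
    have "c * r \<le> K' * r" using K' r by (intro mult_right_mono) auto
    then show "\<exists>w'. (\<forall>h\<in>H. h w' \<le> 0) \<and> norm (w - w') \<le> K' * r"
      using w' order_trans[OF w'(2)] by auto
  qed
qed

section \<open>Error bound for the optimality system of the quadratic program\<close>

lemma subdifferential_box_indicator:
  "v \<in> subdifferential (qp_g l u) z \<longleftrightarrow>
     z \<in> feasible_box l u \<and> (\<forall>w\<in>feasible_box l u. v \<bullet> (w - z) \<le> 0)"
  by (auto simp: subdifferential_def qp_g_def)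

text \<open>A multiplier component of strict sign forces the corresponding bound to be attained; otherwise
  this single coordinate of \<open>z\<close> could be moved inside the box against the subgradient inequality.\<close>
lemma subdifferential_box_complementarity:
  assumes v: "v \<in> subdifferential (qp_g l u) z"
  shows "v $ i > 0 \<Longrightarrow> u $ i = ereal (z $ i)" and "v $ i < 0 \<Longrightarrow> l $ i = ereal (z $ i)"
proof -
  have z: "z \<in> feasible_box l u" and vw: "\<And>w. w \<in> feasible_box l u \<Longrightarrow> v \<bullet> (w - z) \<le> 0"
    using v by (auto simp: subdifferential_box_indicator)
  have move: "v $ i * (t - z $ i) \<le> 0" if "l $ i \<le> ereal t" "ereal t \<le> u $ i" for t
  proof -
    let ?w = "z + (t - z $ i) *\<^sub>R axis i 1"
    have "?w \<in> feasible_box l u"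
      using z that by (auto simp: feasible_box_def axis_def)
    from vw[OF this] show ?thesis by (simp add: inner_axis mult.commute)
  qed
  have zl: "l $ i \<le> ereal (z $ i)" and zu: "ereal (z $ i) \<le> u $ i"
    using z by (auto simp: feasible_box_def)
  show "u $ i = ereal (z $ i)" if "v $ i > 0"
  proof (rule ccontr)
    assume "u $ i \<noteq> ereal (z $ i)"
    then have "ereal (z $ i) < u $ i" using zu by simp
    then obtain t where t: "ereal (z $ i) < ereal t" "ereal t < u $ i"
      using ereal_dense2 by blast
    have "l $ i \<le> ereal t" using zl t(1) by (meson less_imp_le order_trans)
    then have "v $ i * (t - z $ i) \<le> 0" using t(2) by (intro move) auto
    moreover have "0 < v $ i * (t - z $ i)" using t(1) that by simp
    ultimately show False by simp
  qed
  show "l $ i = ereal (z $ i)" if "v $ i < 0"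
  proof (rule ccontr)
    assume "l $ i \<noteq> ereal (z $ i)"
    then have "l $ i < ereal (z $ i)" using zl by simp
    then obtain t where t: "l $ i < ereal t" "ereal t < ereal (z $ i)"
      using ereal_dense2 by blast
    have "ereal t \<le> u $ i" using zu t(2) by (meson less_imp_le order_trans)
    then have "v $ i * (t - z $ i) \<le> 0" using t(1) by (intro move) auto
    moreover have "0 < v $ i * (t - z $ i)" using t(2) that by (simp add: mult_neg_neg)
    ultimately show False by simp
  qed
qed

definition kkt_point where
  "kkt_point Q p A l u x z y \<longleftrightarrow>
     Q *v x + p + transpose A *v y = 0 \<and> A *v x = z \<and> y \<in> subdifferential (qp_g l u) z"

text \<open>The optimality conditions are not convex in \<open>(z, y)\<close> because of complementarity. For a guess \<open>U\<close> and \<open>L\<close>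
  of the upper and lower bounds that are attained, they become linear inequalities \<open>h (x, z, y) \<le> 0\<close>:
  the bounds in \<open>U\<close> and \<open>L\<close> are attained, and outside \<open>U\<close> (outside \<open>L\<close>) the multiplier is not positive
  (not negative). Infinite bounds contribute no inequality.\<close>
definition kkt_system ::
  "real^'n^'n \<Rightarrow> real^'n \<Rightarrow> real^'n^'m \<Rightarrow> ereal^'m \<Rightarrow> ereal^'m \<Rightarrow> 'm set \<Rightarrow> 'm set
    \<Rightarrow> ((real^'n) \<times> (real^'m) \<times> (real^'m) \<Rightarrow> real) set" where
  "kkt_system Q p A l u U L =
     range (\<lambda>j (x, z, y). (Q *v x + p + transpose A *v y) $ j)
     \<union> range (\<lambda>j (x, z, y). - (Q *v x + p + transpose A *v y) $ j)
     \<union> range (\<lambda>i (x, z, y). (A *v x - z) $ i)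
     \<union> range (\<lambda>i (x, z, y). - (A *v x - z) $ i)
     \<union> (\<lambda>i (x, z, y). z $ i - real_of_ereal (u $ i)) ` {i. u $ i \<noteq> \<infinity>}
     \<union> (\<lambda>i (x, z, y). real_of_ereal (l $ i) - z $ i) ` {i. l $ i \<noteq> -\<infinity>}
     \<union> (\<lambda>i (x, z, y). real_of_ereal (u $ i) - z $ i) ` U
     \<union> (\<lambda>i (x, z, y). y $ i) ` (- U)
     \<union> (\<lambda>i (x, z, y). z $ i - real_of_ereal (l $ i)) ` L
     \<union> (\<lambda>i (x, z, y). - y $ i) ` (- L)"

lemma finite_kkt_system: "finite (kkt_system Q p A l u U L)"
  by (simp add: kkt_system_def)

lemma affine_kkt_system: "h \<in> kkt_system Q p A l u U L \<Longrightarrow> affine_function h"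
  unfolding kkt_system_def
  by (auto simp: affine_function_def zero_prod_def linear_iff matrix_vector_right_distrib
      matrix_vector_mult_scaleR vector_matrix_left_distrib scaleR_vector_matrix_assoc
      algebra_simps simp del: transpose_matrix_vector)

lemma kkt_system_iff:
  "(\<forall>h\<in>kkt_system Q p A l u U L. h (x, z, y) \<le> r) \<longleftrightarrow>
     (\<forall>j. \<bar>(Q *v x + p + transpose A *v y) $ j\<bar> \<le> r) \<and> (\<forall>i. \<bar>(A *v x - z) $ i\<bar> \<le> r) \<and>
     (\<forall>i. u $ i \<noteq> \<infinity> \<longrightarrow> z $ i - real_of_ereal (u $ i) \<le> r) \<and>
     (\<forall>i. l $ i \<noteq> -\<infinity> \<longrightarrow> real_of_ereal (l $ i) - z $ i \<le> r) \<and>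
     (\<forall>i\<in>U. real_of_ereal (u $ i) - z $ i \<le> r) \<and> (\<forall>i\<in>-U. y $ i \<le> r) \<and>
     (\<forall>i\<in>L. z $ i - real_of_ereal (l $ i) \<le> r) \<and> (\<forall>i\<in>-L. - y $ i \<le> r)"
  by (simp add: kkt_system_def ball_Un abs_le_iff all_conj_distrib del: transpose_matrix_vector)

lemma kkt_system_solution:
  assumes finite_l: "\<forall>i. l $ i \<noteq> \<infinity>" and finite_u: "\<forall>i. u $ i \<noteq> -\<infinity>"
    and U: "\<forall>i\<in>U. u $ i \<noteq> \<infinity>" and L: "\<forall>i\<in>L. l $ i \<noteq> -\<infinity>"
    and sol: "\<forall>h\<in>kkt_system Q p A l u U L. h (x, z, y) \<le> 0"
  shows "kkt_point Q p A l u x z y"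
proof -
  have "\<forall>j. \<bar>(Q *v x + p + transpose A *v y) $ j\<bar> \<le> 0" "\<forall>i. \<bar>(A *v x - z) $ i\<bar> \<le> 0"
    and zu: "\<And>i. u $ i \<noteq> \<infinity> \<Longrightarrow> z $ i - real_of_ereal (u $ i) \<le> 0"
    and zl: "\<And>i. l $ i \<noteq> -\<infinity> \<Longrightarrow> real_of_ereal (l $ i) - z $ i \<le> 0"
    and onU: "\<And>i. i \<in> U \<Longrightarrow> real_of_ereal (u $ i) - z $ i \<le> 0"
    and offU: "\<And>i. i \<notin> U \<Longrightarrow> y $ i \<le> 0"
    and onL: "\<And>i. i \<in> L \<Longrightarrow> z $ i - real_of_ereal (l $ i) \<le> 0"
    and offL: "\<And>i. i \<notin> L \<Longrightarrow> - y $ i \<le> 0"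
    using sol unfolding kkt_system_iff by blast+
  then have eq: "Q *v x + p + transpose A *v y = 0" "A *v x - z = 0"
    by (simp_all add: vec_eq_iff)
  have real_u: "u $ i = ereal (real_of_ereal (u $ i))" if "u $ i \<noteq> \<infinity>" for i
    using finite_u[rule_format, of i] that by (cases "u $ i") simp_all
  have real_l: "l $ i = ereal (real_of_ereal (l $ i))" if "l $ i \<noteq> -\<infinity>" for i
    using finite_l[rule_format, of i] that by (cases "l $ i") simp_all
  have lz: "l $ i \<le> ereal (z $ i)" for i
  proof (cases "l $ i = -\<infinity>")
    case False
    then show ?thesis using zl[OF False] by (subst real_l) simp_all
  qed simp
  have uz: "ereal (z $ i) \<le> u $ i" for i
  proof (cases "u $ i = \<infinity>")
    case False
    then show ?thesis using zu[OF False] by (subst real_u) simp_all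
  qed simp
  have "y \<bullet> (w - z) \<le> 0" if w: "w \<in> feasible_box l u" for w
  proof -
    have wl: "l $ i \<le> ereal (w $ i)" and wu: "ereal (w $ i) \<le> u $ i" for i
      using w by (auto simp: feasible_box_def)
    have "y $ i * (w $ i - z $ i) \<le> 0" for i
    proof (cases "y $ i" "0::real" rule: linorder_cases)
      case less
      then have i: "i \<in> L" using offL[of i] by force
      then have "ereal (real_of_ereal (l $ i)) \<le> ereal (w $ i)" using wl[of i] real_l L by metis
      then have "z $ i \<le> w $ i" using onL[OF i] by simp
      then show ?thesis using less by (simp add: mult_nonpos_nonneg)
    next
      case greater
      then have i: "i \<in> U" using offU[of i] by force
      then have "ereal (w $ i) \<le> ereal (real_of_ereal (u $ i))" using wu[of i] real_u U by metis
      then have "w $ i \<le> z $ i" using onU[OF i] by simp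
      then show ?thesis using greater by (simp add: mult_nonneg_nonpos)
    qed simp
    then show ?thesis by (simp add: inner_vec_def sum_nonpos)
  qed
  then show ?thesis
    using eq lz uz by (auto simp: kkt_point_def subdifferential_box_indicator feasible_box_def)
qed

text \<open>The guess of attained bounds is read off the signs of the exact subgradient \<open>v\<close>. With this guess
  \<open>(x, z, y)\<close> violates the linear system by at most the residual \<open>r\<close>, and there are only finitely
  many guesses, so that a single constant \<open>K\<close> works for all of them.\<close>
lemma kkt_error_bound:
  fixes Q :: "real^'n^'n" and A :: "real^'n^'m"
  assumes finite_l: "\<forall>i. l $ i \<noteq> \<infinity>" and finite_u: "\<forall>i. u $ i \<noteq> -\<infinity>"
  obtains K where "K \<ge> 0"
    "\<And>x z y v r. \<lbrakk>v \<in> subdifferential (qp_g l u) z; norm (Q *v x + p + transpose A *v y) \<le> r;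
        norm (v - y) \<le> r; norm (A *v x - z) \<le> r; K * r < 1\<rbrakk> \<Longrightarrow>
       \<exists>x' z' y'. kkt_point Q p A l u x' z' y' \<and>
          norm (x - x') \<le> K * r \<and> norm (z - z') \<le> K * r \<and> norm (y - y') \<le> K * r"
proof -
  let ?bound = "\<lambda>(U, L) K. \<forall>w r. 0 \<le> r \<and> K * r < 1 \<and> (\<forall>h\<in>kkt_system Q p A l u U L. h w \<le> r) \<longrightarrow>
       (\<exists>w'. (\<forall>h\<in>kkt_system Q p A l u U L. h w' \<le> 0) \<and> norm (w - w') \<le> K * r)"
  have "\<exists>K\<ge>0. \<forall>UL\<in>UNIV. ?bound UL K"
  proof (rule finite_uniform_bound)
    show "\<forall>UL\<in>UNIV. \<exists>K. \<forall>K'\<ge>K. ?bound UL K'"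
      unfolding split_paired_all split_beta
      by (intro ballI hoffman_error_bound finite_kkt_system affine_kkt_system)
  qed simp
  then obtain K where K: "K \<ge> 0" and bound: "\<And>U L. ?bound (U, L) K" by blast
  show ?thesis
  proof (rule that[OF K])
    fix x z y v r
    assume v: "v \<in> subdifferential (qp_g l u) z"
      and r: "norm (Q *v x + p + transpose A *v y) \<le> r" "norm (v - y) \<le> r"
        "norm (A *v x - z) \<le> r" "K * r < 1"
    \<comment> \<open>The bounds at these indices are attained, because \<open>v\<close> is an exact subgradient at \<open>z\<close>.\<close>
    define U where "U = {i. v $ i > 0}"
    define L where "L = {i. v $ i < 0}"
    note compl = subdifferential_box_complementarity[OF v]
    have z: "z \<in> feasible_box l u" using v by (simp add: subdifferential_box_indicator)
    have r0: "0 \<le> r" using r(2) norm_ge_zero order_trans by blast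
    have y: "\<bar>v $ i - y $ i\<bar> \<le> r" for i using component_le_norm_cart[of "v - y" i] r(2) by simp
    have zu: "z $ i \<le> real_of_ereal (u $ i)" if "u $ i \<noteq> \<infinity>" for i
      using z that finite_u by (cases "u $ i") (auto simp: feasible_box_def dest!: spec[of _ i])
    have zl: "real_of_ereal (l $ i) \<le> z $ i" if "l $ i \<noteq> -\<infinity>" for i
      using z that finite_l by (cases "l $ i") (auto simp: feasible_box_def dest!: spec[of _ i])
    have "\<forall>h\<in>kkt_system Q p A l u U L. h (x, z, y) \<le> r"
      unfolding kkt_system_iff
    proof (intro conjI allI ballI impI)
      show "\<bar>(Q *v x + p + transpose A *v y) $ j\<bar> \<le> r" for j
        by (rule order_trans[OF component_le_norm_cart r(1)])
      show "\<bar>(A *v x - z) $ i\<bar> \<le> r" for i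
        by (rule order_trans[OF component_le_norm_cart r(3)])
      show "z $ i - real_of_ereal (u $ i) \<le> r" if "u $ i \<noteq> \<infinity>" for i
        using zu[OF that] r0 by simp
      show "real_of_ereal (l $ i) - z $ i \<le> r" if "l $ i \<noteq> -\<infinity>" for i
        using zl[OF that] r0 by simp
      show "real_of_ereal (u $ i) - z $ i \<le> r" if "i \<in> U" for i
        using compl(1)[of i] that r0 by (simp add: U_def)
      show "z $ i - real_of_ereal (l $ i) \<le> r" if "i \<in> L" for i
        using compl(2)[of i] that r0 by (simp add: L_def)
      show "y $ i \<le> r" if "i \<in> - U" for i using that y[of i] by (simp add: U_def)
      show "- y $ i \<le> r" if "i \<in> - L" for i using that y[of i] by (simp add: L_def)
    qed
    then obtain x' z' y' where sol: "\<forall>h\<in>kkt_system Q p A l u U L. h (x', z', y') \<le> 0"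
      and near: "norm ((x, z, y) - (x', z', y')) \<le> K * r"
      using bound[of U L] r0 r(4) by (auto simp: split_beta) blast
    have "kkt_point Q p A l u x' z' y'"
      by (rule kkt_system_solution[OF finite_l finite_u _ _ sol])
        (use compl in \<open>force simp: U_def L_def\<close>)+
    moreover have "norm (x - x') \<le> K * r" "norm (z - z') \<le> K * r" "norm (y - y') \<le> K * r"
      using near norm_fst_le[of "x - x'" "(z - z', y - y')"] norm_snd_le[of "(z - z', y - y')" "x - x'"]
        norm_fst_le[of "z - z'" "y - y'"] norm_snd_le[of "y - y'" "z - z'"] by simp_all
    ultimately show "\<exists>x' z' y'. kkt_point Q p A l u x' z' y' \<and>
          norm (x - x') \<le> K * r \<and> norm (z - z') \<le> K * r \<and> norm (y - y') \<le> K * r" by blast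
  qed
qed

lemma qp_f_tangent:
  assumes "psd Q"
  shows "qp_f Q p x + (Q *v x + p) \<bullet> (x' - x) \<le> qp_f Q p x'"
proof -
  have sym: "transpose Q = Q" and nn: "0 \<le> (x' - x) \<bullet> (Q *v (x' - x))"
    using assms by (auto simp: psd_def)
  have "x' \<bullet> (Q *v x) = x \<bullet> (Q *v x')"
    by (metis sym symmetric_inner_matrix inner_commute)
  then show ?thesis
    using nn by (simp add: qp_f_def matrix_vector_mult_diff_distrib inner_diff_left
        inner_diff_right inner_add_left inner_commute[of "Q *v _"] algebra_simps)
qed

text \<open>The Lagrangian with optimal multiplier attains its minimum over all \<open>x\<close> and all feasible \<open>z\<close> at the
  optimal pair, by convexity of the objective and the subgradient inequality of the box.\<close>
lemma kkt_point_lower_bound: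
  assumes "psd Q" and kkt: "kkt_point Q p A l u x' z' y'" and z: "z \<in> feasible_box l u"
  shows "qp_f Q p x' \<le> qp_f Q p x + y' \<bullet> (A *v x - z)"
proof -
  have "Q *v x' + p = - (transpose A *v y')" 
    using kkt by (simp add: kkt_point_def eq_neg_iff_add_eq_0)
  then have "(Q *v x' + p) \<bullet> (x - x') = - (y' \<bullet> (A *v x - z'))"
    using kkt transpose_inner[of A y' "x - x'"]
    by (simp add: kkt_point_def matrix_vector_mult_diff_distrib)
  moreover have "y' \<bullet> (z - z') \<le> 0"
    using kkt z by (simp add: kkt_point_def subdifferential_box_indicator)
  ultimately show ?thesis
    using qp_f_tangent[OF assms(1), of p x' x] by (simp add: inner_diff_right)
qed

lemma kkt_point_optimal:
  assumes "psd Q" and kkt: "kkt_point Q p A l u x' z' y'"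
  shows "qp_optimal Q p A l u x'"
  using kkt_point_lower_bound[OF assms, of "A *v x" x for x] kkt
  by (auto simp: qp_optimal_def kkt_point_def subdifferential_box_indicator)

lemma inner_le_of_norm_le:
  fixes a b :: "'a::real_inner"
  assumes "norm a \<le> r" "norm b \<le> s"
  shows "a \<bullet> b \<le> r * s"
proof -
  have "a \<bullet> b \<le> norm a * norm b" by (rule norm_cauchy_schwarz)
  also have "\<dots> \<le> r * s"
    by (intro mult_mono assms) (use assms(1) norm_ge_zero order_trans in \<open>blast, simp\<close>)
  finally show ?thesis .
qed

text \<open>Compare with a nearby optimal primal-dual point \<open>(x', z', y')\<close>. From below, minimality of
  the Lagrangian for the multiplier \<open>y'\<close> leaves the error \<open>(y' - y) \<bullet> (A *v x - z)\<close>; from above,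
  convexity at \<open>(x, z)\<close> leaves the residuals paired with \<open>x - x'\<close> and \<open>z - z'\<close>. Each
  error is a residual times a distance, and both factors are of order \<open>r\<close>.\<close>
lemma lagrangian_error_bound:
  fixes Q :: "real^'n^'n" and A :: "real^'n^'m"
  assumes "psd Q" and finite_l: "\<forall>i. l $ i \<noteq> \<infinity>" and finite_u: "\<forall>i. u $ i \<noteq> -\<infinity>"
  obtains K where "K \<ge> 0"
    "\<And>x z y v r. \<lbrakk>v \<in> subdifferential (qp_g l u) z; norm (Q *v x + p + transpose A *v y) \<le> r;
        norm (v - y) \<le> r; norm (A *v x - z) \<le> r; K * r < 1\<rbrakk> \<Longrightarrow>
       \<exists>x'. qp_optimal Q p A l u x' \<and>
          \<bar>qp_f Q p x + y \<bullet> (A *v x - z) - qp_f Q p x'\<bar> \<le> 2 * K * r\<^sup>2"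
proof -
  obtain K where K: "K \<ge> 0" and near:
    "\<And>x z y v r. \<lbrakk>v \<in> subdifferential (qp_g l u) z; norm (Q *v x + p + transpose A *v y) \<le> r;
        norm (v - y) \<le> r; norm (A *v x - z) \<le> r; K * r < 1\<rbrakk> \<Longrightarrow>
       \<exists>x' z' y'. kkt_point Q p A l u x' z' y' \<and>
          norm (x - x') \<le> K * r \<and> norm (z - z') \<le> K * r \<and> norm (y - y') \<le> K * r"
    using kkt_error_bound[OF finite_l finite_u] by blast
  show ?thesis
  proof (rule that[OF K])
    fix x z y v r
    assume v: "v \<in> subdifferential (qp_g l u) z"
      and r: "norm (Q *v x + p + transpose A *v y) \<le> r" "norm (v - y) \<le> r"
        "norm (A *v x - z) \<le> r" "K * r < 1"
    obtain x' z' y' where kkt: "kkt_point Q p A l u x' z' y'"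
      and d: "norm (x - x') \<le> K * r" "norm (z - z') \<le> K * r" "norm (y - y') \<le> K * r"
      using near[OF v r] by blast
    have r0: "0 \<le> r" using r(2) norm_ge_zero order_trans by blast
    have z: "z \<in> feasible_box l u" using v by (simp add: subdifferential_box_indicator)
    have "qp_f Q p x' \<le> qp_f Q p x + y \<bullet> (A *v x - z) + (A *v x - z) \<bullet> (y' - y)"
      using kkt_point_lower_bound[OF assms(1) kkt z, of x]
      by (simp add: inner_diff_left inner_diff_right inner_commute)
    moreover have "(A *v x - z) \<bullet> (y' - y) \<le> K * r\<^sup>2"
      using inner_le_of_norm_le[OF r(3), of "y' - y" "K * r"] d(3)
      by (simp add: norm_minus_commute power2_eq_square mult_ac)
    ultimately have lower: "- (K * r\<^sup>2) \<le> qp_f Q p x + y \<bullet> (A *v x - z) - qp_f Q p x'" by linarith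
    define e where "e = Q *v x + p + transpose A *v y"
    have "qp_f Q p x + (Q *v x + p) \<bullet> (x' - x) \<le> qp_f Q p x'"
      by (rule qp_f_tangent[OF assms(1)])
    moreover have "(Q *v x + p) \<bullet> (x' - x) = - (e \<bullet> (x - x')) + y \<bullet> (A *v x - z')"
      using kkt transpose_inner[of A y "x - x'"]
      by (simp add: e_def kkt_point_def matrix_vector_mult_diff_distrib inner_diff_right
          inner_add_left)
    moreover have "v \<bullet> (z' - z) \<le> 0"
      using v kkt by (simp add: subdifferential_box_indicator kkt_point_def)
    ultimately have "qp_f Q p x + y \<bullet> (A *v x - z) - qp_f Q p x' \<le>
        e \<bullet> (x - x') + (v - y) \<bullet> (z - z')"
      by (simp add: inner_diff_left inner_diff_right)
    moreover have "e \<bullet> (x - x') \<le> K * r\<^sup>2" "(v - y) \<bullet> (z - z') \<le> K * r\<^sup>2"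
      using inner_le_of_norm_le[OF r(1) d(1)] inner_le_of_norm_le[OF r(2) d(2)]
      by (simp_all add: e_def power2_eq_square mult_ac)
    moreover have "0 \<le> K * r\<^sup>2" using K by simp
    ultimately have "\<bar>qp_f Q p x + y \<bullet> (A *v x - z) - qp_f Q p x'\<bar> \<le> 2 * K * r\<^sup>2"
      using lower by linarith
    then show "\<exists>x'. qp_optimal Q p A l u x' \<and>
          \<bar>qp_f Q p x + y \<bullet> (A *v x - z) - qp_f Q p x'\<bar> \<le> 2 * K * r\<^sup>2"
      using kkt_point_optimal[OF assms(1) kkt] by blast
  qed
qed

lemma qp_optimal_value_unique:
  assumes "qp_optimal Q p A l u x" "qp_optimal Q p A l u x'"
  shows "qp_f Q p x = qp_f Q p x'"
  using assms unfolding qp_optimal_def by (meson order_antisym)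

section \<open>Sequences with sufficient decrease\<close>

lemma sufficient_decrease_limit:
  fixes a D :: "nat \<Rightarrow> real"
  assumes c: "c > 0" and D: "\<And>n. D n \<ge> 0"
    and decrease: "\<And>n. a (Suc n) + c * D n \<le> a n" and below: "\<And>n. B \<le> a n"
  obtains F where "a \<longlonglongrightarrow> F" "\<And>n. F \<le> a n" "D \<longlonglongrightarrow> 0"
proof -
  have "c * D n \<ge> 0" for n using c D by simp
  then have "decseq a" using decrease by (intro decseq_SucI) (smt (verit))
  then obtain F where F: "a \<longlonglongrightarrow> F" "\<And>n. F \<le> a n"
    using decseq_convergent[of a B] below by blast
  have "(\<lambda>n. (a n - a (Suc n)) / c) \<longlonglongrightarrow> (F - F) / c"
    by (intro tendsto_intros F LIMSEQ_Suc) (use c in simp)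
  then have "(\<lambda>n. (a n - a (Suc n)) / c) \<longlonglongrightarrow> 0" by simp
  moreover have "D n \<le> (a n - a (Suc n)) / c" for n
    using decrease[of n] c by (simp add: pos_le_divide_eq mult.commute)
  ultimately have "D \<longlonglongrightarrow> 0"
    using D by (intro tendsto_sandwich[of "\<lambda>_. 0" D sequentially]) auto
  then show ?thesis using F that by blast
qed

text \<open>The gap \<open>a (Suc n) - F\<close> is at most \<open>C * D n\<close>, and \<open>c * D n\<close> is at most the decrease of the gap;
  so the gap contracts by the factor \<open>C / (C + c)\<close> and \<open>D\<close>, being bounded by the gap, decays
  geometrically.\<close>
lemma decrease_with_error_bound_summable_sqrt:
  fixes a D :: "nat \<Rightarrow> real"
  assumes c: "c > 0" and D: "\<And>n. D n \<ge> 0"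
    and decrease: "\<And>n. a (Suc n) + c * D n \<le> a n"
    and below: "\<And>n. F \<le> a n"
    and C: "C > 0" and error: "\<forall>\<^sub>F n in sequentially. a (Suc n) - F \<le> C * D n"
  shows "summable (\<lambda>n. sqrt (D n))"
proof -
  define b where "b n = a n - F" for n
  define \<theta> where "\<theta> = C / (C + c)"
  have \<theta>: "0 < \<theta>" "\<theta> < 1" using c C by (auto simp: \<theta>_def)
  obtain N where N: "\<And>n. n \<ge> N \<Longrightarrow> b (Suc n) \<le> C * D n"
    using error by (auto simp: eventually_sequentially b_def)
  have contract: "b (Suc n) \<le> \<theta> * b n" if "n \<ge> N" for n
  proof -
    have "c * b (Suc n) \<le> C * (c * D n)" 
      using mult_left_mono[OF N[OF that], of c] c by (simp add: mult_ac)
    also have "\<dots> \<le> C * (b n - b (Suc n))"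
      using decrease[of n] C by (intro mult_left_mono) (auto simp: b_def)
    finally have "b (Suc n) * (C + c) \<le> C * b n" by (simp add: algebra_simps)
    then have "b (Suc n) \<le> C * b n / (C + c)" using c C by (simp add: pos_le_divide_eq)
    then show ?thesis by (simp add: \<theta>_def)
  qed
  have geometric: "b (N + k) \<le> \<theta> ^ k * b N" for k
  proof (induction k)
    case (Suc k)
    have "b (N + Suc k) \<le> \<theta> * b (N + k)" using contract[of "N + k"] by simp
    also have "\<dots> \<le> \<theta> * (\<theta> ^ k * b N)" using Suc \<theta> by (intro mult_left_mono) auto
    finally show ?case by (simp add: mult_ac)
  qed simp
  have "sqrt (D (N + k)) \<le> sqrt (b N / c) * sqrt \<theta> ^ k" for k
  proof -
    have "c * D (N + k) \<le> b (N + k)" 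
      using decrease[of "N + k"] below[of "Suc (N + k)"] by (simp add: b_def)
    also note geometric[of k]
    finally have "D (N + k) \<le> \<theta> ^ k * b N / c"
      using c by (simp add: pos_le_divide_eq mult.commute)
    then have "D (N + k) \<le> b N / c * \<theta> ^ k" by (simp add: mult.commute)
    then have "sqrt (D (N + k)) \<le> sqrt (b N / c * \<theta> ^ k)" by (rule real_sqrt_le_mono)
    then show ?thesis by (simp only: real_sqrt_mult real_sqrt_power)
  qed
  then have "norm (sqrt (D (k + N))) \<le> sqrt (b N / c) * sqrt \<theta> ^ k" for k
    using D[of "k + N"] by (simp add: add.commute[of k N])
  moreover have "summable (\<lambda>k. sqrt (b N / c) * sqrt \<theta> ^ k)"
    using \<theta> by (intro summable_mult summable_geometric) simp
  ultimately have "summable (\<lambda>k. sqrt (D (k + N)))"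
    by (rule summable_comparison_test'[rotated])
  then show ?thesis using summable_iff_shift[of "\<lambda>n. sqrt (D n)" N] by blast
qed

lemma convergent_of_summable_steps:
  fixes X :: "nat \<Rightarrow> 'a::banach"
  assumes "summable g" and "\<And>n. norm (X (Suc n) - X n) \<le> g n"
  shows "convergent X"
proof -
  have "summable (\<lambda>n. X (Suc n) - X n)"
    by (rule summable_comparison_test'[OF assms(1), where N = 0]) (rule assms(2))
  then have "convergent (\<lambda>n. \<Sum>i<n. X (Suc i) - X i)" by (simp add: summable_iff_convergent)
  then have "convergent (\<lambda>n. (X n - X 0) + X 0)"
    unfolding sum_lessThan_telescope by (intro convergent_add convergent_const)
  then show ?thesis by simp
qed

lemma summable_power2:
  fixes b :: "nat \<Rightarrow> real"
  assumes b: "summable b" and nonneg: "\<And>k. 0 \<le> b k"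
  shows "summable (\<lambda>k. (b k)\<^sup>2)"
proof (rule summable_comparison_test_ev[OF _ b])
  have "\<forall>\<^sub>F k in sequentially. b k < 1"
    using order_tendstoD(2)[OF summable_LIMSEQ_zero[OF b], of 1] by simp
  then show "\<forall>\<^sub>F k in sequentially. norm ((b k)\<^sup>2) \<le> b k"
    by eventually_elim (use nonneg in \<open>simp add: power2_eq_square mult_left_le\<close>)
qed

text \<open>If the least of the first \<open>K\<close> terms exceeded \<open>sqrt S / sqrt K\<close>, the sum of their squares would exceed
  \<open>S\<close>; take for \<open>S\<close> any number above the sum of the whole series.\<close>
lemma min_rate_of_square_summable:
  fixes d :: "nat \<Rightarrow> ereal"
  assumes le: "\<And>k. k \<ge> 1 \<Longrightarrow> d k \<le> ereal (b k)" and b: "summable (\<lambda>k. (b k)\<^sup>2)"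
  shows "\<exists>C::real. \<forall>\<^sub>F K in sequentially. Min (d ` {1..K}) \<le> ereal (C / sqrt (real K))"
proof -
  define S where "S = (\<Sum>k. (b k)\<^sup>2) + 1"
  have S: "S > 0" using suminf_nonneg[OF b] by (simp add: S_def add_nonneg_pos)
  have "Min (d ` {1..K}) \<le> ereal (sqrt S / sqrt (real K))" if K: "K \<ge> 1" for K
  proof (rule ccontr)
    assume "\<not> Min (d ` {1..K}) \<le> ereal (sqrt S / sqrt (real K))"
    then have large: "ereal (sqrt S / sqrt (real K)) < Min (d ` {1..K})" by simp
    have "S / real K \<le> (b k)\<^sup>2" if k: "k \<in> {1..K}" for k
    proof -
      have "Min (d ` {1..K}) \<le> d k" using k by (intro Min_le) auto
      also have "\<dots> \<le> ereal (b k)" using le k by simp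
      finally have "ereal (sqrt S / sqrt (real K)) < ereal (b k)" using large by (rule less_le_trans[rotated])
      then have "(sqrt S / sqrt (real K))\<^sup>2 \<le> (b k)\<^sup>2" using S by (intro power_mono) auto
      then show ?thesis using S by (simp add: power_divide)
    qed
    then have "(\<Sum>k\<in>{1..K}. S / real K) \<le> (\<Sum>k\<in>{1..K}. (b k)\<^sup>2)" by (rule sum_mono)
    also have "\<dots> \<le> (\<Sum>k. (b k)\<^sup>2)" using b by (intro sum_le_suminf) auto
    finally show False using K by (simp add: S_def)
  qed
  then show ?thesis by (auto simp: eventually_sequentially)
qed

section \<open>Norm estimates, limits and distances\<close>

\<comment> \<open>The rewrite to \<open>w v* A\<close> would hide the linearity of \<open>w \<mapsto> transpose A *v w\<close>.\<close>
declare transpose_matrix_vector [simp del]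

text \<open>The weights 2 and 8 are those of the parameter conditions: \<open>P\<close> stands for the two contributions of the
  current \<open>x\<close>-step, the other four terms for the remaining steps, with \<open>8 = 2 * 4\<close>.\<close>
lemma sum_square_bound:
  fixes P a b c d :: real
  shows "(P + a + b + c + d)\<^sup>2 \<le> 2 * P\<^sup>2 + 8 * (a\<^sup>2 + b\<^sup>2 + c\<^sup>2 + d\<^sup>2)"
proof -
  have two: "(s + t)\<^sup>2 \<le> 2 * (s\<^sup>2 + t\<^sup>2)" for s t :: real
    using zero_le_power2[of "s - t"] by (simp add: power2_eq_square algebra_simps)
  have "(P + ((a + b) + (c + d)))\<^sup>2 \<le> 2 * (P\<^sup>2 + ((a + b) + (c + d))\<^sup>2)" by (rule two)
  moreover have "((a + b) + (c + d))\<^sup>2 \<le> 2 * ((a + b)\<^sup>2 + (c + d)\<^sup>2)" by (rule two)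
  ultimately show ?thesis using two[of a b] two[of c d] by (simp add: add.assoc)
qed

lemma matrix_norm_bound:
  fixes M :: "real^'n^'m"
  shows "\<exists>a\<ge>0. \<forall>w. norm (M *v w) \<le> a * norm w"
  using linear_bounded_pos[of "\<lambda>w. M *v w"] by (metis less_imp_le matrix_vector_mul_linear)

lemma tendsto_matrix_vector_mult [tendsto_intros]:
  fixes M :: "real^'n^'m"
  shows "(f \<longlongrightarrow> a) F \<Longrightarrow> ((\<lambda>k. M *v f k) \<longlongrightarrow> M *v a) F"
  by (rule bounded_linear.tendsto[OF matrix_vector_mul_bounded_linear])

lemma tendsto_qp_f [tendsto_intros]: "(f \<longlongrightarrow> a) F \<Longrightarrow> ((\<lambda>k. qp_f Q p (f k)) \<longlongrightarrow> qp_f Q p a) F"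
  unfolding qp_f_def by (intro tendsto_intros)

lemma feasible_box_limit:
  assumes "\<And>k. w k \<in> feasible_box l u" and w: "w \<longlonglongrightarrow> w0"
  shows "w0 \<in> feasible_box l u"
proof -
  have "l $ i \<le> ereal (w0 $ i) \<and> ereal (w0 $ i) \<le> u $ i" for i
  proof -
    have "(\<lambda>k. ereal (w k $ i)) \<longlonglongrightarrow> ereal (w0 $ i)" by (intro tendsto_intros w)
    moreover have "l $ i \<le> ereal (w k $ i)" "ereal (w k $ i) \<le> u $ i" for k
      using assms(1)[of k] by (auto simp: feasible_box_def)
    ultimately show ?thesis by (meson LIMSEQ_le_const LIMSEQ_le_const2)
  qed
  then show ?thesis by (simp add: feasible_box_def)
qed

lemma edist_nonneg: "0 \<le> edist v C"
  unfolding edist_def by (intro INF_greatest) simp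

lemma edist_zero_le_norm: "w \<in> C \<Longrightarrow> norm w \<le> b \<Longrightarrow> edist 0 C \<le> ereal b"
  unfolding edist_def by (rule INF_lower2) auto

lemma norm_triple_le: "norm (a, b, c) \<le> norm a + norm b + norm c"
  using norm_Pair_le[of a "(b, c)"] norm_Pair_le[of b c] by linarith

lemma tendsto_zero_edist:
  assumes "\<And>k. edist 0 (C (Suc k)) \<le> ereal (b k)" "b \<longlonglongrightarrow> 0"
  shows "(\<lambda>k. edist 0 (C k)) \<longlonglongrightarrow> 0"
proof (rule LIMSEQ_imp_Suc, rule tendsto_sandwich[of "\<lambda>_. 0" _ _ "\<lambda>k. ereal (b k)"])
  show "(\<lambda>k. ereal (b k)) \<longlonglongrightarrow> 0" using assms(2) by (simp add: zero_ereal_def)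
qed (use assms(1) edist_nonneg in \<open>auto intro!: always_eventually\<close>)

section \<open>The inexact ADMM iteration\<close>

text \<open>The three conditions on the parameters enter as plain inequalities. Indices start with the first
  computed iterate: \<open>z 0\<close> need not satisfy the bounds, so the augmented Lagrangian is known to be
  finite only from \<open>z (Suc 0)\<close> on, where \<open>aug\<close> below is its value.\<close>
locale admm_run =
  fixes Q :: "real^'n^'n" and p :: "real^'n" and A :: "real^'n^'m"
    and l u :: "ereal^'m"
    and \<rho> \<beta>x \<beta>z cx cz \<delta> \<tau> :: real
    and x xt :: "nat \<Rightarrow> real^'n" and z y :: "nat \<Rightarrow> real^'m"
  assumes psd_Q: "psd Q"
    and finite_l: "\<forall>i. l $ i \<noteq> \<infinity>" and finite_u: "\<forall>i. u $ i \<noteq> -\<infinity>"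
    and pos: "\<rho> > 0" "\<beta>x > 0" "\<beta>z > 0" "cx > 0" "cz > 0" "0 < \<tau>"
    and run: "inexact_admm Q p A l u \<rho> \<beta>x \<beta>z cx cz \<delta> x xt z y"
    and surj: "\<forall>w::real^'m. w \<in> range (\<lambda>v. A *v v)"
    and cond_x: "(2 * (sigma_max Q / \<rho> + cx)\<^sup>2 + 8 * cx\<^sup>2) / sigma_min (transpose A ** A)
        \<le> \<beta>x * (1 - \<tau>) / (2 * (1 + \<tau>))"
    and cond_S: "8 * (sigma_max Q / \<rho>)\<^sup>2 / sigma_min (transpose A ** A) \<le> (\<delta> - \<tau>) / (1 + \<tau>)"
    and cond_z: "16 * kappa (transpose A ** A) \<le> \<beta>z * (1 - \<tau>) / (2 * (1 + \<tau>))"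
    and below: "\<exists>B::real. \<forall>k\<ge>1. ereal B \<le> E_tilde Q p A l u \<rho> cx \<tau> x xt z y k"
begin

abbreviation (input) smin where "smin \<equiv> sigma_min (transpose A ** A)"
abbreviation (input) smax where "smax \<equiv> sigma_max (transpose A ** A)"

definition dx where "dx k = xt (Suc k) - x k"
definition dh where "dh k = x (Suc k) - xt (Suc k)"
definition dz where "dz k = z (Suc k) - z k"
definition r where "r k = A *v xt (Suc k) - z (Suc k)"

definition aug :: "real^'n \<Rightarrow> real^'m \<Rightarrow> real^'m \<Rightarrow> real" where
  "aug a b c = qp_f Q p a + c \<bullet> (A *v a - b) + \<rho> / 2 * (norm (A *v a - b))\<^sup>2"

definition energy :: "nat \<Rightarrow> real" where
  "energy n = aug (xt (Suc n)) (z (Suc n)) (y (Suc n)) + Gamma_tilde A \<rho> cx \<tau> x xt z n"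

text \<open>The squared lengths that \<open>energy n - energy (Suc n)\<close> is compared with. The relaxation step \<open>dh\<close> has
  the smaller index because it follows the point at which \<open>energy n\<close> is measured.\<close>
definition D :: "nat \<Rightarrow> real" where
  "D n = (norm (dx (Suc n)))\<^sup>2 + (norm (dz (Suc n)))\<^sup>2 + (norm (r (Suc n)))\<^sup>2 + (norm (dh n))\<^sup>2"

lemma AugLagr_eq: "b \<in> feasible_box l u \<Longrightarrow> AugLagr Q p A l u \<rho> a b c = ereal (aug a b c)"
  by (simp add: AugLagr_def Lagr_def qp_g_def aug_def)

lemma dual_subgradient:
  obtains v where "v \<in> subdifferential (qp_g l u) (z (Suc k))"
    "norm (v - y (Suc k)) \<le> cz * \<rho> * (norm (dz k) + norm (dx k))"
proof -
  have "\<exists>\<xi>\<in>subdiff_z_AugLagr A l u \<rho> (xt (Suc k)) (z (Suc k)) (y k).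
      norm \<xi> \<le> cz * \<rho> * (norm (dz k) + norm (dx k))"
    and y: "y (Suc k) = y k + \<rho> *\<^sub>R r k"
    using run unfolding inexact_admm_def dz_def dx_def r_def by blast+
  then obtain v where v: "v \<in> subdifferential (qp_g l u) (z (Suc k))"
    "norm (v - y k - \<rho> *\<^sub>R r k) \<le> cz * \<rho> * (norm (dz k) + norm (dx k))"
    unfolding subdiff_z_AugLagr_def r_def by blast
  moreover have "v - y k - \<rho> *\<^sub>R r k = v - y (Suc k)" using y by simp
  ultimately show thesis using that by simp
qed

lemma z_feasible: "z (Suc k) \<in> feasible_box l u"
  by (rule dual_subgradient[of k]) (simp add: subdifferential_box_indicator)

lemma x_step_descent:
  "aug (xt (Suc (Suc k))) (z (Suc k)) (y (Suc k)) + \<rho> * \<beta>x / 2 * (norm (dx (Suc k)))\<^sup>2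
     \<le> aug (x (Suc k)) (z (Suc k)) (y (Suc k))"
proof -
  have "AugLagr Q p A l u \<rho> (xt (Suc (Suc k))) (z (Suc k)) (y (Suc k))
          + ereal (\<rho> * \<beta>x / 2 * (norm (xt (Suc (Suc k)) - x (Suc k)))\<^sup>2)
        \<le> AugLagr Q p A l u \<rho> (x (Suc k)) (z (Suc k)) (y (Suc k))"
    using run unfolding inexact_admm_def by blast
  then show ?thesis by (simp add: AugLagr_eq[OF z_feasible] dx_def)
qed

lemma z_step_descent:
  "aug (xt (Suc (Suc k))) (z (Suc (Suc k))) (y (Suc k)) + \<rho> * \<beta>z / 2 * (norm (dz (Suc k)))\<^sup>2
     \<le> aug (xt (Suc (Suc k))) (z (Suc k)) (y (Suc k))"
proof -
  have "AugLagr Q p A l u \<rho> (xt (Suc (Suc k))) (z (Suc (Suc k))) (y (Suc k))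
          + ereal (\<rho> * \<beta>z / 2 * (norm (z (Suc (Suc k)) - z (Suc k)))\<^sup>2)
        \<le> AugLagr Q p A l u \<rho> (xt (Suc (Suc k))) (z (Suc k)) (y (Suc k))"
    using run unfolding inexact_admm_def by blast
  then show ?thesis by (simp add: AugLagr_eq[OF z_feasible] dz_def)
qed

lemma relaxation_descent:
  "aug (x (Suc k)) (z (Suc k)) (y (Suc k)) + \<delta> * \<rho> * (norm (dh k))\<^sup>2
     \<le> aug (xt (Suc k)) (z (Suc k)) (y (Suc k))"
proof -
  have "AugLagr Q p A l u \<rho> (x (Suc k)) (z (Suc k)) (y (Suc k))
            \<le> AugLagr Q p A l u \<rho> (xt (Suc k)) (z (Suc k)) (y (Suc k))
              - ereal (\<delta> * \<rho> * (norm (x (Suc k) - xt (Suc k)))\<^sup>2)"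
    using run unfolding inexact_admm_def by blast
  then show ?thesis by (simp add: AugLagr_eq[OF z_feasible] dh_def algebra_simps)
qed

lemma y_step: "y (Suc k) = y k + \<rho> *\<^sub>R r k"
  using run unfolding inexact_admm_def r_def by blast

lemma y_step_ascent:
  "aug (xt (Suc k)) (z (Suc k)) (y (Suc k)) = aug (xt (Suc k)) (z (Suc k)) (y k) + \<rho> * (norm (r k))\<^sup>2"
  by (simp add: aug_def y_step inner_add_left r_def[symmetric] power2_norm_eq_inner)

text \<open>The gradient error of the \<open>x\<close>-step, written with the updated multiplier: replacing \<open>y k\<close> by
  \<open>y (Suc k)\<close> absorbs the penalty term except for the change of \<open>z\<close>.\<close>
definition \<xi> where "\<xi> k = Q *v xt (Suc k) + p + transpose A *v y (Suc k) + \<rho> *\<^sub>R (transpose A *v dz k)"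

lemma norm_\<xi>: "norm (\<xi> k) \<le> cx * \<rho> * norm (dx k)"
proof -
  have "norm (grad_x_AugLagr Q p A \<rho> (xt (Suc k)) (z k) (y k)) \<le> cx * \<rho> * norm (dx k)"
    using run unfolding inexact_admm_def dx_def by blast
  moreover have "grad (qp_f Q p) (xt (Suc k)) = Q *v xt (Suc k) + p"
    by (rule grad_qp_f) (use psd_Q in \<open>simp add: psd_def\<close>)
  moreover have "A *v xt (Suc k) - z k = r k + dz k" by (simp add: r_def dz_def)
  ultimately show ?thesis
    by (simp add: grad_x_AugLagr_def \<xi>_def y_step matrix_vector_right_distrib
        matrix_vector_mult_scaleR scaleR_add_right add_ac)
qed

text \<open>Subtract the stationarity equations of two consecutive \<open>x\<close>-steps. The difference of the
  multipliers, \<open>\<rho> *\<^sub>R r (Suc k)\<close>, appears under the injective map \<open>transpose A\<close>, and everything else is a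
  step length or a gradient error bounded by one.\<close>
lemma dual_step_bound:
  "smin * (norm (r (Suc k)))\<^sup>2 \<le> 2 * ((sigma_max Q / \<rho> + cx) * norm (dx (Suc k)))\<^sup>2
     + 8 * ((cx * norm (dx k))\<^sup>2 + (sigma_max Q / \<rho> * norm (dh k))\<^sup>2
        + smax * (norm (dz (Suc k)))\<^sup>2 + smax * (norm (dz k))\<^sup>2)"
proof -
  let ?q = "sigma_max Q"
  let ?T = "\<lambda>w. transpose A *v w"
  have triangle: "norm (a - b - c - d - e + f) \<le> norm a + norm c + norm b + norm d + norm e + norm f"
    for a b c d e f :: "real^'n"
    by norm
  have xt: "xt (Suc (Suc k)) = xt (Suc k) + dx (Suc k) + dh k" by (simp add: dx_def dh_def)
  have "\<rho> *\<^sub>R ?T (r (Suc k)) = ?T (y (Suc (Suc k))) - ?T (y (Suc k))"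
    by (simp add: y_step[of "Suc k"] matrix_vector_right_distrib matrix_vector_mult_scaleR)
  also have "\<dots> = \<xi> (Suc k) - \<xi> k - Q *v dx (Suc k) - Q *v dh k
      - \<rho> *\<^sub>R ?T (dz (Suc k)) + \<rho> *\<^sub>R ?T (dz k)"
    by (simp add: \<xi>_def xt matrix_vector_right_distrib)
  finally have eq: "\<rho> *\<^sub>R ?T (r (Suc k)) = \<dots>" .
  have "\<rho> * norm (?T (r (Suc k))) = norm (\<rho> *\<^sub>R ?T (r (Suc k)))" using pos by simp
  also have "\<dots> \<le> (norm (\<xi> (Suc k)) + norm (Q *v dx (Suc k))) + norm (\<xi> k) + norm (Q *v dh k)
      + norm (\<rho> *\<^sub>R ?T (dz (Suc k))) + norm (\<rho> *\<^sub>R ?T (dz k))"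
    unfolding eq by (rule triangle)
  also have "\<dots> \<le> (cx * \<rho> * norm (dx (Suc k)) + ?q * norm (dx (Suc k))) + cx * \<rho> * norm (dx k)
      + ?q * norm (dh k) + \<rho> * norm (?T (dz (Suc k))) + \<rho> * norm (?T (dz k))"
    using pos by (intro add_mono norm_\<xi> norm_le_sigma_max[OF psd_Q]) auto
  also have "\<dots> = \<rho> * ((?q / \<rho> + cx) * norm (dx (Suc k)) + cx * norm (dx k) + ?q / \<rho> * norm (dh k)
      + norm (?T (dz (Suc k))) + norm (?T (dz k)))"
    using pos by (simp add: field_simps)
  finally have "norm (?T (r (Suc k))) \<le> (?q / \<rho> + cx) * norm (dx (Suc k)) + cx * norm (dx k)
      + ?q / \<rho> * norm (dh k) + norm (?T (dz (Suc k))) + norm (?T (dz k))"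
    using pos by simp
  then have "(norm (?T (r (Suc k))))\<^sup>2 \<le> ((?q / \<rho> + cx) * norm (dx (Suc k)) + cx * norm (dx k)
      + ?q / \<rho> * norm (dh k) + norm (?T (dz (Suc k))) + norm (?T (dz k)))\<^sup>2"
    by (intro power_mono) auto
  also have "\<dots> \<le> 2 * ((?q / \<rho> + cx) * norm (dx (Suc k)))\<^sup>2
      + 8 * ((cx * norm (dx k))\<^sup>2 + (?q / \<rho> * norm (dh k))\<^sup>2
        + (norm (?T (dz (Suc k))))\<^sup>2 + (norm (?T (dz k)))\<^sup>2)"
    by (rule sum_square_bound)
  finally show ?thesis
    using sigma_min_surjective(2)[OF surj, of "r (Suc k)"]
      norm_transpose_le_sigma_max[of A "dz (Suc k)"] norm_transpose_le_sigma_max[of A "dz k"]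
    by argo
qed

text \<open>The least of the coefficients \<open>\<tau> * \<rho> * \<beta>x / 2\<close>, \<open>\<tau> * \<rho> * \<beta>z / 2\<close> and \<open>\<tau> * \<rho>\<close> that remain in front of
  the squared steps once the parameter conditions have paid for the multiplier update.\<close>
definition rate where "rate = \<tau> * \<rho> * min 1 (min (\<beta>x / 2) (\<beta>z / 2))"

lemma rate_pos: "rate > 0" using pos by (simp add: rate_def)

text \<open>The residual term \<open>\<rho> * ?R\<close> is multiplied by \<open>1 + \<tau>\<close>, bounded by \<open>dual_step_bound\<close>, and split
  into terms of the present step, paid for by the descent of that step, and terms of the previous
  step, which are exactly the \<open>Gamma_tilde\<close> part of \<open>energy n\<close>.\<close>
lemma energy_descent: "energy (Suc n) + rate * D n \<le> energy n"
proof -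
  let ?X' = "(norm (dx (Suc n)))\<^sup>2" and ?X = "(norm (dx n))\<^sup>2" and ?H = "(norm (dh n))\<^sup>2"
    and ?Z' = "(norm (dz (Suc n)))\<^sup>2" and ?Z = "(norm (dz n))\<^sup>2" and ?R = "(norm (r (Suc n)))\<^sup>2"
  define g where "g = (1 + \<tau>) * \<rho>"
  define ax where "ax = g * (2 * (sigma_max Q / \<rho> + cx)\<^sup>2 / smin)"
  define bx where "bx = g * (8 * cx\<^sup>2 / smin)"
  define ah where "ah = g * (8 * (sigma_max Q / \<rho>)\<^sup>2 / smin)"
  define az where "az = g * (8 * (smax / smin))"
  have smin: "smin > 0" by (rule sigma_min_surjective(1)[OF surj])
  have g: "g > 0" using pos by (simp add: g_def)
  have t1: "1 + \<tau> > 0" using pos by simp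
  have "ax + bx = g * ((2 * (sigma_max Q / \<rho> + cx)\<^sup>2 + 8 * cx\<^sup>2) / smin)"
    by (simp add: ax_def bx_def add_divide_distrib distrib_left)
  also have "\<dots> \<le> g * (\<beta>x * (1 - \<tau>) / (2 * (1 + \<tau>)))"
    using g by (intro mult_left_mono cond_x) simp
  also have "\<dots> = \<rho> * \<beta>x / 2 - \<tau> * \<rho> * (\<beta>x / 2)"
    using t1 by (simp add: g_def field_simps)
  finally have hx: "(ax + bx) * ?X' \<le> (\<rho> * \<beta>x / 2 - \<tau> * \<rho> * (\<beta>x / 2)) * ?X'"
    by (rule mult_right_mono) simp
  have "ah \<le> g * ((\<delta> - \<tau>) / (1 + \<tau>))"
    unfolding ah_def using g by (intro mult_left_mono cond_S) simp
  also have "\<dots> = \<rho> * \<delta> - \<tau> * \<rho>" using t1 by (simp add: g_def field_simps)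
  finally have hh: "ah * ?H \<le> (\<rho> * \<delta> - \<tau> * \<rho>) * ?H" by (rule mult_right_mono) simp
  have "2 * az = g * (16 * kappa (transpose A ** A))" by (simp add: az_def kappa_def)
  also have "\<dots> \<le> g * (\<beta>z * (1 - \<tau>) / (2 * (1 + \<tau>)))"
    using g by (intro mult_left_mono cond_z) simp
  also have "\<dots> = \<rho> * \<beta>z / 2 - \<tau> * \<rho> * (\<beta>z / 2)"
    using t1 by (simp add: g_def field_simps)
  finally have hz: "2 * az * ?Z' \<le> (\<rho> * \<beta>z / 2 - \<tau> * \<rho> * (\<beta>z / 2)) * ?Z'"
    by (rule mult_right_mono) simp
  have "g * ?R = g / smin * (smin * ?R)" using smin by simp
  also have "\<dots> \<le> g / smin * (2 * ((sigma_max Q / \<rho> + cx) * norm (dx (Suc n)))\<^sup>2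
     + 8 * ((cx * norm (dx n))\<^sup>2 + (sigma_max Q / \<rho> * norm (dh n))\<^sup>2 + smax * ?Z' + smax * ?Z))"
    using g smin by (intro mult_left_mono dual_step_bound) simp
  also have "\<dots> = ax * ?X' + bx * ?X + ah * ?H + az * ?Z' + az * ?Z"
    unfolding ax_def bx_def ah_def az_def power_mult_distrib
    by (simp add: algebra_simps add_divide_distrib)
  finally have hr: "\<rho> * ?R + \<tau> * \<rho> * ?R \<le> ax * ?X' + bx * ?X + ah * ?H + az * ?Z' + az * ?Z"
    by (simp add: g_def algebra_simps)
  have \<Gamma>: "Gamma_tilde A \<rho> cx \<tau> x xt z k = bx * (norm (dx k))\<^sup>2 + az * (norm (dz k))\<^sup>2" for k
    by (simp add: Gamma_tilde_def bx_def az_def g_def kappa_def dx_def dz_def mult_ac)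
  have "rate * D n \<le> \<tau> * \<rho> * (\<beta>x / 2) * ?X' + \<tau> * \<rho> * (\<beta>z / 2) * ?Z' + \<tau> * \<rho> * ?R + \<tau> * \<rho> * ?H"
  proof -
    have "rate \<le> \<tau> * \<rho> * (\<beta>x / 2)" "rate \<le> \<tau> * \<rho> * (\<beta>z / 2)" "rate \<le> \<tau> * \<rho> * 1"
      unfolding rate_def using pos by (intro mult_left_mono; simp)+
    then show ?thesis unfolding D_def distrib_left by (intro add_mono mult_right_mono) auto
  qed
  then show ?thesis
    using hx hh hz hr x_step_descent[of n] z_step_descent[of n] relaxation_descent[of n]
      y_step_ascent[of "Suc n"]
    unfolding energy_def \<Gamma> left_diff_distrib distrib_right mult.commute[of \<delta> \<rho>] by linarith
qed

lemma D_nonneg: "D n \<ge> 0" by (simp add: D_def)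

lemma steps_le_sqrt_D:
  "norm (dx (Suc n)) \<le> sqrt (D n)" "norm (dz (Suc n)) \<le> sqrt (D n)"
  "norm (r (Suc n)) \<le> sqrt (D n)" "norm (dh n) \<le> sqrt (D n)"
  by (simp_all add: D_def real_le_rsqrt)

lemma energy_below: obtains B where "\<And>n. B \<le> energy n"
proof -
  obtain B where B: "\<And>k. k \<ge> 1 \<Longrightarrow> ereal B \<le> E_tilde Q p A l u \<rho> cx \<tau> x xt z y k"
    using below by blast
  have "B \<le> energy n" for n
    using B[of "Suc n"] by (simp add: E_tilde_def energy_def AugLagr_eq[OF z_feasible])
  then show thesis by (rule that)
qed

text \<open>At the point \<open>(xt (Suc k), z (Suc k), y (Suc k))\<close> the multiplier update turns both inexactness
  conditions into bounds for the residual of the optimality system.\<close>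
lemma kkt_residual_bound:
  obtains M where "M \<ge> 1"
    "\<And>k. norm (Q *v xt (Suc k) + p + transpose A *v y (Suc k)) \<le> M * (norm (dx k) + norm (dz k))"
    "\<And>k. \<exists>v\<in>subdifferential (qp_g l u) (z (Suc k)).
        norm (v - y (Suc k)) \<le> M * (norm (dx k) + norm (dz k))"
proof -
  obtain a where a: "a \<ge> 0" "\<And>w. norm (transpose A *v w) \<le> a * norm w"
    using matrix_norm_bound[of "transpose A"] by blast
  define M where "M = 1 + cx * \<rho> + cz * \<rho> + \<rho> * a"
  have M: "1 \<le> M" "cx * \<rho> \<le> M" "\<rho> * a \<le> M" "cz * \<rho> \<le> M"
    using pos a(1) by (simp_all add: M_def)
  have 1: "norm (Q *v xt (Suc k) + p + transpose A *v y (Suc k)) \<le> M * (norm (dx k) + norm (dz k))" for k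
  proof -
    have "Q *v xt (Suc k) + p + transpose A *v y (Suc k) = \<xi> k - \<rho> *\<^sub>R (transpose A *v dz k)"
      by (simp add: \<xi>_def)
    also have "norm \<dots> \<le> norm (\<xi> k) + norm (\<rho> *\<^sub>R (transpose A *v dz k))"
      by (rule norm_triangle_ineq4)
    also have "\<dots> \<le> cx * \<rho> * norm (dx k) + \<rho> * (a * norm (dz k))"
      using pos a by (intro add_mono norm_\<xi>) simp
    also have "\<dots> \<le> M * norm (dx k) + M * norm (dz k)"
      unfolding mult.assoc[symmetric, of \<rho>] using M by (intro add_mono mult_right_mono) auto
    finally show ?thesis by (simp add: distrib_left)
  qed
  have 2: "\<exists>v\<in>subdifferential (qp_g l u) (z (Suc k)).
        norm (v - y (Suc k)) \<le> M * (norm (dx k) + norm (dz k))" for k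
  proof -
    obtain v where v: "v \<in> subdifferential (qp_g l u) (z (Suc k))"
      "norm (v - y (Suc k)) \<le> cz * \<rho> * (norm (dz k) + norm (dx k))"
      by (rule dual_subgradient)
    note v(2)
    also have "cz * \<rho> * (norm (dz k) + norm (dx k)) \<le> M * (norm (dz k) + norm (dx k))"
      using M by (intro mult_right_mono) auto
    finally show ?thesis using v(1) by (auto simp: add.commute)
  qed
  show thesis by (rule that[OF M(1) 1 2])
qed

text \<open>The error bound applies as soon as the steps are short, and then also provides the optimal solution
  \<open>xo\<close>. The penalty term and \<open>Gamma_tilde\<close> are multiples of squared steps themselves.\<close>
lemma energy_near_optimal_value:
  assumes D0: "D \<longlonglongrightarrow> 0"
  obtains xo C where "qp_optimal Q p A l u xo" "C > 0"
    "\<forall>\<^sub>F n in sequentially. \<bar>energy (Suc n) - qp_f Q p xo\<bar> \<le> C * D n"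
proof -
  obtain M where M: "M \<ge> 1"
    "\<And>k. norm (Q *v xt (Suc k) + p + transpose A *v y (Suc k)) \<le> M * (norm (dx k) + norm (dz k))"
    "\<And>k. \<exists>v\<in>subdifferential (qp_g l u) (z (Suc k)).
        norm (v - y (Suc k)) \<le> M * (norm (dx k) + norm (dz k))"
    by (rule kkt_residual_bound) blast
  obtain K where K: "K \<ge> 0" and near:
    "\<And>x z y v r. \<lbrakk>v \<in> subdifferential (qp_g l u) z; norm (Q *v x + p + transpose A *v y) \<le> r;
        norm (v - y) \<le> r; norm (A *v x - z) \<le> r; K * r < 1\<rbrakk> \<Longrightarrow>
       \<exists>x'. qp_optimal Q p A l u x' \<and>
          \<bar>qp_f Q p x + y \<bullet> (A *v x - z) - qp_f Q p x'\<bar> \<le> 2 * K * r\<^sup>2"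
    using lagrangian_error_bound[OF psd_Q finite_l finite_u] by blast
  define rad where "rad n = 2 * M * sqrt (D n)" for n
  have "(\<lambda>n. K * rad n) \<longlonglongrightarrow> K * (2 * M * sqrt 0)"
    unfolding rad_def by (intro tendsto_intros D0)
  then have small: "\<forall>\<^sub>F n in sequentially. K * rad n < 1"
    using order_tendstoD(2)[of "\<lambda>n. K * rad n" 0 sequentially 1] by simp
  have sum_le: "M * (norm (dx (Suc n)) + norm (dz (Suc n))) \<le> rad n" for n
    using mult_left_mono[of "norm (dx (Suc n)) + norm (dz (Suc n))" "2 * sqrt (D n)" M]
      steps_le_sqrt_D(1,2)[of n] M(1) by (simp add: rad_def mult_ac)
  have r_le: "norm (r (Suc n)) \<le> rad n" for n
  proof -
    have "1 * sqrt (D n) \<le> 2 * M * sqrt (D n)"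
      using M(1) D_nonneg by (intro mult_right_mono) auto
    then show ?thesis using steps_le_sqrt_D(3)[of n] by (simp add: rad_def)
  qed
  have rad_sq: "(rad n)\<^sup>2 = 4 * M\<^sup>2 * D n" for n
    using D_nonneg by (simp add: rad_def power_mult_distrib)
  let ?x = "\<lambda>n. xt (Suc (Suc n))" and ?z = "\<lambda>n. z (Suc (Suc n))" and ?y = "\<lambda>n. y (Suc (Suc n))"
  have close: "\<exists>x'. qp_optimal Q p A l u x' \<and>
      \<bar>qp_f Q p (?x n) + ?y n \<bullet> (A *v ?x n - ?z n) - qp_f Q p x'\<bar> \<le> 8 * K * M\<^sup>2 * D n"
    if "K * rad n < 1" for n
  proof -
    obtain v where v: "v \<in> subdifferential (qp_g l u) (?z n)"
        "norm (v - ?y n) \<le> M * (norm (dx (Suc n)) + norm (dz (Suc n)))"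
      using M(3)[of "Suc n"] by blast
    have "\<exists>x'. qp_optimal Q p A l u x' \<and>
      \<bar>qp_f Q p (?x n) + ?y n \<bullet> (A *v ?x n - ?z n) - qp_f Q p x'\<bar> \<le> 2 * K * (rad n)\<^sup>2"
    proof (rule near[OF v(1)])
      show "norm (Q *v ?x n + p + transpose A *v ?y n) \<le> rad n"
        by (rule order_trans[OF M(2) sum_le])
      show "norm (v - ?y n) \<le> rad n" by (rule order_trans[OF v(2) sum_le])
      show "norm (A *v ?x n - ?z n) \<le> rad n" using r_le[of n] by (simp add: r_def)
    qed (rule that)
    then show ?thesis by (simp add: rad_sq mult_ac)
  qed
  obtain N where "K * rad N < 1" using eventually_happens'[OF _ small] by auto
  then obtain xo where xo: "qp_optimal Q p A l u xo" using close by blast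
  define s where "s = 8 * (1 + \<tau>) * cx\<^sup>2 * \<rho> / smin"
  define t where "t = 8 * (1 + \<tau>) * \<rho> * kappa (transpose A ** A)"
  define C where "C = 8 * K * M\<^sup>2 + \<rho> / 2 + \<bar>s\<bar> + \<bar>t\<bar>"
  have "\<bar>energy (Suc n) - qp_f Q p xo\<bar> \<le> C * D n" if small: "K * rad n < 1" for n
  proof -
    obtain x' where opt: "qp_optimal Q p A l u x'" and
      x': "\<bar>qp_f Q p (?x n) + ?y n \<bullet> (A *v ?x n - ?z n) - qp_f Q p x'\<bar> \<le> 8 * K * M\<^sup>2 * D n"
      using close[OF small] by blast
    have same_value: "qp_f Q p x' = qp_f Q p xo" using opt xo by (rule qp_optimal_value_unique)
    have "energy (Suc n) = (qp_f Q p (?x n) + ?y n \<bullet> (A *v ?x n - ?z n))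
        + \<rho> / 2 * (norm (r (Suc n)))\<^sup>2 + s * (norm (dx (Suc n)))\<^sup>2 + t * (norm (dz (Suc n)))\<^sup>2"
      by (simp add: energy_def aug_def Gamma_tilde_def s_def t_def r_def dx_def dz_def)
    moreover have "\<rho> / 2 * (norm (r (Suc n)))\<^sup>2 \<le> \<rho> / 2 * D n" "0 \<le> \<rho> / 2 * (norm (r (Suc n)))\<^sup>2"
      using pos by (auto intro!: mult_left_mono simp: D_def)
    moreover have "\<bar>s * (norm (dx (Suc n)))\<^sup>2\<bar> \<le> \<bar>s\<bar> * D n" "\<bar>t * (norm (dz (Suc n)))\<^sup>2\<bar> \<le> \<bar>t\<bar> * D n"
      unfolding abs_mult by (auto intro!: mult_left_mono simp: D_def)
    ultimately have "\<bar>energy (Suc n) - qp_f Q p xo\<bar>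
        \<le> 8 * K * M\<^sup>2 * D n + \<rho> / 2 * D n + \<bar>s\<bar> * D n + \<bar>t\<bar> * D n"
      using x' unfolding same_value by linarith
    then show ?thesis by (simp add: C_def distrib_right)
  qed
  then have "\<forall>\<^sub>F n in sequentially. \<bar>energy (Suc n) - qp_f Q p xo\<bar> \<le> C * D n"
    by (rule eventually_mono[OF small])
  moreover have "C > 0"
  proof -
    have "0 \<le> 8 * K * M\<^sup>2" using K by simp
    then show ?thesis using pos(1) unfolding C_def by linarith
  qed
  ultimately show thesis by (intro that[OF xo])
qed

definition step :: "nat \<Rightarrow> real" where
  "step k = norm (dx k) + norm (dz k) + norm (r k) + norm (dh k)"

text \<open>The energy has two descriptions of its limit, as the limit of a decreasing sequence and as the
  optimal value; their agreement turns the error bound into the hypothesis of the linear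
  contraction.\<close>
lemma finite_length:
  obtains xo where "qp_optimal Q p A l u xo" "energy \<longlonglongrightarrow> qp_f Q p xo" "summable step"
proof -
  obtain B where B: "\<And>n. B \<le> energy n" by (rule energy_below) blast
  obtain F where F: "energy \<longlonglongrightarrow> F" "\<And>n. F \<le> energy n" and D0: "D \<longlonglongrightarrow> 0"
    using sufficient_decrease_limit[of rate D energy B, OF rate_pos D_nonneg energy_descent B] by blast
  obtain xo C where xo: "qp_optimal Q p A l u xo" and C: "C > 0"
    and near: "\<forall>\<^sub>F n in sequentially. \<bar>energy (Suc n) - qp_f Q p xo\<bar> \<le> C * D n"
    using energy_near_optimal_value[OF D0] by blast
  have "(\<lambda>n. C * D n) \<longlonglongrightarrow> 0" using tendsto_mult_right_zero[OF D0] by simp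
  then have "(\<lambda>n. energy (Suc n) - qp_f Q p xo) \<longlonglongrightarrow> 0"
    by (rule Lim_null_comparison[rotated]) (use near in simp)
  then have "(\<lambda>n. energy (Suc n)) \<longlonglongrightarrow> qp_f Q p xo" by (simp add: LIM_zero_iff)
  then have lim: "energy \<longlonglongrightarrow> qp_f Q p xo" by (rule LIMSEQ_imp_Suc)
  then have F_eq: "F = qp_f Q p xo" using F(1) LIMSEQ_unique by blast
  have "\<forall>\<^sub>F n in sequentially. energy (Suc n) - F \<le> C * D n"
    unfolding F_eq by (rule eventually_mono[OF near]) linarith
  then have G: "summable (\<lambda>n. sqrt (D n))"
    by (rule decrease_with_error_bound_summable_sqrt[of rate D energy F C, OF rate_pos D_nonneg energy_descent F(2) C])
  then have "summable (\<lambda>n. 3 * sqrt (D n) + sqrt (D (Suc n)))"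
    using summable_Suc_iff[of "\<lambda>n. sqrt (D n)"] by (intro summable_add summable_mult) blast+
  moreover have "norm (step (Suc n)) \<le> 3 * sqrt (D n) + sqrt (D (Suc n))" for n
  proof -
    have "norm (step (Suc n)) = step (Suc n)" by (simp add: step_def)
    then show ?thesis
      using steps_le_sqrt_D(1-3)[of n] steps_le_sqrt_D(4)[of "Suc n"] unfolding step_def by linarith
  qed
  ultimately have "summable (\<lambda>n. step (Suc n))"
    by (rule summable_comparison_test'[where N = 0])
  then have "summable step" using summable_Suc_iff[of step] by blast
  then show thesis by (rule that[OF xo lim])
qed

lemma null_of_le_step:
  assumes "summable step" and "\<And>k. norm (f k) \<le> step k"
  shows "f \<longlonglongrightarrow> 0"
  using summable_LIMSEQ_zero[OF assms(1)] assms(2)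
  by (intro Lim_null_comparison[of f step] always_eventually allI)

text \<open>Along the convergent iterates the penalty and \<open>Gamma_tilde\<close> vanish, so the energy tends to the
  objective at the limit. It also tends to the optimal value, and the limit is feasible, because the
  box is closed and the primal residual tends to \<open>0\<close>.\<close>
lemma iterates_converge:
  obtains xs zs ys where "x \<longlonglongrightarrow> xs" "z \<longlonglongrightarrow> zs" "y \<longlonglongrightarrow> ys" "zs = A *v xs"
    "qp_optimal Q p A l u xs" "energy \<longlonglongrightarrow> qp_f Q p xs" "summable step"
proof -
  obtain xo where xo: "qp_optimal Q p A l u xo" and lim: "energy \<longlonglongrightarrow> qp_f Q p xo"
    and step: "summable step" by (rule finite_length)
  have "convergent x"
  proof (rule convergent_of_summable_steps[OF step])
    fix k
    have "norm (x (Suc k) - x k) = norm (dx k + dh k)" by (simp add: dx_def dh_def)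
    also have "\<dots> \<le> norm (dx k) + norm (dh k)" by (rule norm_triangle_ineq)
    also have "\<dots> \<le> step k" by (simp add: step_def)
    finally show "norm (x (Suc k) - x k) \<le> step k" .
  qed
  moreover have "convergent z"
    by (rule convergent_of_summable_steps[OF step]) (simp add: step_def dz_def[symmetric])
  moreover have "convergent y"
  proof (rule convergent_of_summable_steps[OF summable_mult[OF step]])
    show "norm (y (Suc k) - y k) \<le> \<rho> * step k" for k
      using pos by (simp add: step_def y_step)
  qed
  ultimately obtain xs zs ys where conv: "x \<longlonglongrightarrow> xs" "z \<longlonglongrightarrow> zs" "y \<longlonglongrightarrow> ys"
    unfolding convergent_def by blast
  note null = null_of_le_step[OF step]
  have r0: "r \<longlonglongrightarrow> 0" and dx0: "dx \<longlonglongrightarrow> 0" and dh0: "dh \<longlonglongrightarrow> 0" and dz0: "dz \<longlonglongrightarrow> 0"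
    by (auto intro!: null simp: step_def)
  have conv_Suc: "(\<lambda>k. x (Suc k)) \<longlonglongrightarrow> xs" "(\<lambda>k. z (Suc k)) \<longlonglongrightarrow> zs" "(\<lambda>k. y (Suc k)) \<longlonglongrightarrow> ys"
    using conv by (auto intro: LIMSEQ_Suc)
  have "(\<lambda>k. x (Suc k) - dh k) \<longlonglongrightarrow> xs - 0" by (intro tendsto_intros conv_Suc dh0)
  then have xt: "(\<lambda>k. xt (Suc k)) \<longlonglongrightarrow> xs" by (simp add: dh_def)
  have "r \<longlonglongrightarrow> A *v xs - zs" unfolding r_def by (intro tendsto_intros xt conv_Suc)
  then have zs: "zs = A *v xs" using r0 LIMSEQ_unique by fastforce
  have box: "zs \<in> feasible_box l u" by (rule feasible_box_limit[OF z_feasible conv_Suc(2)])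
  have "energy \<longlonglongrightarrow> aug xs zs ys +
      (8 * (1 + \<tau>) * cx\<^sup>2 * \<rho> / smin * (norm (0 :: real^'n))\<^sup>2
        + 8 * (1 + \<tau>) * \<rho> * kappa (transpose A ** A) * (norm (0 :: real^'m))\<^sup>2)"
    unfolding energy_def aug_def Gamma_tilde_def dx_def[symmetric] dz_def[symmetric]
    by (intro tendsto_intros xt conv_Suc dx0 dz0)
  then have "energy \<longlonglongrightarrow> qp_f Q p xs" by (simp add: aug_def zs)
  then have "qp_f Q p xs = qp_f Q p xo" using lim LIMSEQ_unique by blast
  then have "qp_optimal Q p A l u xs" using xo box by (simp add: qp_optimal_def zs)
  then show thesis by (rule that[OF conv zs _ \<open>energy \<longlonglongrightarrow> qp_f Q p xs\<close> step])
qed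

text \<open>The residual estimates hold at \<open>xt (Suc k)\<close>; passing to \<open>x (Suc k)\<close> costs a multiple of the relaxation
  step \<open>dh k\<close>, which is part of \<open>step k\<close>.\<close>
lemma stationarity_bound:
  obtains M where
    "\<And>k. edist 0 (subdiff_Lagr Q p A l u (x (Suc k)) (z (Suc k)) (y (Suc k))) \<le> ereal (M * step k)"
    "\<And>k. edist 0 (subdiff_AugLagr Q p A l u \<rho> (x (Suc k)) (z (Suc k)) (y (Suc k))) \<le> ereal (M * step k)"
proof -
  obtain M0 where M0: "M0 \<ge> 1"
    "\<And>k. norm (Q *v xt (Suc k) + p + transpose A *v y (Suc k)) \<le> M0 * (norm (dx k) + norm (dz k))"
    "\<And>k. \<exists>v\<in>subdifferential (qp_g l u) (z (Suc k)).
        norm (v - y (Suc k)) \<le> M0 * (norm (dx k) + norm (dz k))"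
    by (rule kkt_residual_bound) blast
  obtain q where q: "q \<ge> 0" "\<And>w. norm (Q *v w) \<le> q * norm w"
    using matrix_norm_bound[of Q] by blast
  obtain a where a: "a \<ge> 0" "\<And>w. norm (A *v w) \<le> a * norm w"
    using matrix_norm_bound[of A] by blast
  obtain t where t: "t \<ge> 0" "\<And>w. norm (transpose A *v w) \<le> t * norm w"
    using matrix_norm_bound[of "transpose A"] by blast
  define M where "M = (M0 + q + \<rho> * t * (1 + a)) + (M0 + \<rho> * (1 + a)) + (1 + a)"
  have "edist 0 (subdiff_Lagr Q p A l u (x (Suc k)) (z (Suc k)) (y (Suc k))) \<le> ereal (M * step k) \<and>
    edist 0 (subdiff_AugLagr Q p A l u \<rho> (x (Suc k)) (z (Suc k)) (y (Suc k))) \<le> ereal (M * step k)" for k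
  proof -
    let ?x = "x (Suc k)" and ?z = "z (Suc k)" and ?y = "y (Suc k)"
    define e1 where "e1 = Q *v ?x + p + transpose A *v ?y"
    define e3 where "e3 = A *v ?x - ?z"
    obtain v where v: "v \<in> subdifferential (qp_g l u) ?z"
      "norm (v - ?y) \<le> M0 * (norm (dx k) + norm (dz k))" using M0(3) by blast
    have step0: "0 \<le> step k" by (simp add: step_def)
    have parts: "norm (dx k) + norm (dz k) \<le> step k" "norm (dh k) \<le> step k" "norm (r k) \<le> step k"
      by (simp_all add: step_def)
    have sum_le: "M0 * (norm (dx k) + norm (dz k)) \<le> M0 * step k"
      using M0(1) parts(1) by (intro mult_left_mono) auto
    have "e1 = (Q *v xt (Suc k) + p + transpose A *v ?y) + Q *v dh k"
      by (simp add: e1_def dh_def matrix_vector_mult_diff_distrib)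
    then have "norm e1 \<le> norm (Q *v xt (Suc k) + p + transpose A *v ?y) + norm (Q *v dh k)"
      by (simp only: norm_triangle_ineq)
    also have "\<dots> \<le> M0 * step k + q * step k"
      using order_trans[OF M0(2) sum_le] order_trans[OF q(2) mult_left_mono[OF parts(2) q(1)]]
      by (rule add_mono)
    finally have e1: "norm e1 \<le> (M0 + q) * step k" by (simp add: distrib_right)
    have e2: "norm (v - ?y) \<le> M0 * step k" by (rule order_trans[OF v(2) sum_le])
    have "e3 = r k + A *v dh k"
      by (simp add: e3_def r_def dh_def matrix_vector_mult_diff_distrib)
    then have "norm e3 \<le> norm (r k) + norm (A *v dh k)" by (simp only: norm_triangle_ineq)
    also have "\<dots> \<le> step k + a * step k"
      using parts(3) order_trans[OF a(2) mult_left_mono[OF parts(2) a(1)]] by (rule add_mono)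
    finally have e3: "norm e3 \<le> (1 + a) * step k" by (simp add: distrib_right)
    have extra: "0 \<le> \<rho> * t * (1 + a) * step k" "0 \<le> \<rho> * (1 + a) * step k"
      using pos t a step0 by simp_all
    have grad: "grad (qp_f Q p) ?x = Q *v ?x + p"
      by (rule grad_qp_f) (use psd_Q in \<open>simp add: psd_def\<close>)
    have "edist 0 (subdiff_Lagr Q p A l u ?x ?z ?y) \<le> ereal (M * step k)"
    proof (rule edist_zero_le_norm)
      show "(e1, v - ?y, e3) \<in> subdiff_Lagr Q p A l u ?x ?z ?y"
        using v(1) by (auto simp: subdiff_Lagr_def grad e1_def e3_def)
      show "norm (e1, v - ?y, e3) \<le> M * step k"
        using norm_triple_le[of e1 "v - ?y" e3] e1 e2 e3 extra
        unfolding M_def distrib_right[of _ _ "step k"] by linarith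
    qed
    moreover have "edist 0 (subdiff_AugLagr Q p A l u \<rho> ?x ?z ?y) \<le> ereal (M * step k)"
    proof (rule edist_zero_le_norm)
      let ?w1 = "e1 + \<rho> *\<^sub>R (transpose A *v e3)" and ?w2 = "v - ?y - \<rho> *\<^sub>R e3"
      show "(?w1, ?w2, e3) \<in> subdiff_AugLagr Q p A l u \<rho> ?x ?z ?y"
        using v(1) by (auto simp: subdiff_AugLagr_def grad_x_AugLagr_def subdiff_z_AugLagr_def
            grad e1_def e3_def)
      have "norm (\<rho> *\<^sub>R (transpose A *v e3)) \<le> \<rho> * t * (1 + a) * step k"
        using pos mult_left_mono[OF order_trans[OF t(2) mult_left_mono[OF e3 t(1)]], of \<rho>]
        by (simp add: mult.assoc)
      moreover have "norm (\<rho> *\<^sub>R e3) \<le> \<rho> * (1 + a) * step k"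
        using pos mult_left_mono[OF e3, of \<rho>] by (simp add: mult.assoc)
      ultimately show "norm (?w1, ?w2, e3) \<le> M * step k"
        using norm_triple_le[of ?w1 ?w2 e3] e1 e2 e3 
          norm_triangle_ineq[of e1 "\<rho> *\<^sub>R (transpose A *v e3)"]
          norm_triangle_ineq4[of "v - ?y" "\<rho> *\<^sub>R e3"]
        unfolding M_def distrib_right[of _ _ "step k"] by linarith
    qed
    ultimately show ?thesis ..
  qed
  then show thesis using that by blast
qed

end

lemma (in admm_run) functionals_converge:
  assumes "x \<longlonglongrightarrow> xs" "z \<longlonglongrightarrow> zs" "y \<longlonglongrightarrow> ys" and zs: "zs = A *v xs"
    and energy: "energy \<longlonglongrightarrow> qp_f Q p xs" and step: "summable step"
  shows "(\<lambda>k. Lagr Q p A l u (x k) (z k) (y k)) \<longlonglongrightarrow> ereal (qp_f Q p xs)"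
    and "(\<lambda>k. AugLagr Q p A l u \<rho> (x k) (z k) (y k)) \<longlonglongrightarrow> ereal (qp_f Q p xs)"
    and "E_full Q p A l u \<rho> cx \<tau> x xt z y \<longlonglongrightarrow> ereal (qp_f Q p xs)"
    and "E_tilde Q p A l u \<rho> cx \<tau> x xt z y \<longlonglongrightarrow> ereal (qp_f Q p xs)"
proof -
  have Suc: "(\<lambda>k. x (Suc k)) \<longlonglongrightarrow> xs" "(\<lambda>k. z (Suc k)) \<longlonglongrightarrow> zs" "(\<lambda>k. y (Suc k)) \<longlonglongrightarrow> ys"
    using assms(1-3) by (auto intro: LIMSEQ_Suc)
  have null: "dx \<longlonglongrightarrow> 0" "dh \<longlonglongrightarrow> 0" "dz \<longlonglongrightarrow> 0"
    by (auto intro!: null_of_le_step[OF step] simp: step_def)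
  have "(\<lambda>k. qp_f Q p (x (Suc k)) + y (Suc k) \<bullet> (A *v x (Suc k) - z (Suc k)))
      \<longlonglongrightarrow> qp_f Q p xs + ys \<bullet> (A *v xs - zs)"
    by (intro tendsto_intros Suc)
  then have "(\<lambda>k. ereal (qp_f Q p (x (Suc k)) + y (Suc k) \<bullet> (A *v x (Suc k) - z (Suc k))))
      \<longlonglongrightarrow> ereal (qp_f Q p xs)" by (simp add: zs)
  then show "(\<lambda>k. Lagr Q p A l u (x k) (z k) (y k)) \<longlonglongrightarrow> ereal (qp_f Q p xs)"
    by (intro LIMSEQ_imp_Suc[of "\<lambda>k. Lagr Q p A l u (x k) (z k) (y k)"])
      (simp add: Lagr_def qp_g_def z_feasible)
  have "(\<lambda>k. aug (x (Suc k)) (z (Suc k)) (y (Suc k))) \<longlonglongrightarrow> aug xs zs ys"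
    unfolding aug_def by (intro tendsto_intros Suc)
  then have aug: "(\<lambda>k. aug (x (Suc k)) (z (Suc k)) (y (Suc k))) \<longlonglongrightarrow> qp_f Q p xs"
    by (simp add: aug_def zs)
  then show "(\<lambda>k. AugLagr Q p A l u \<rho> (x k) (z k) (y k)) \<longlonglongrightarrow> ereal (qp_f Q p xs)"
    by (intro LIMSEQ_imp_Suc[of "\<lambda>k. AugLagr Q p A l u \<rho> (x k) (z k) (y k)"])
      (simp add: AugLagr_eq[OF z_feasible])
  have "Gamma_full Q A \<rho> cx \<tau> x xt z \<longlonglongrightarrow>
      8 * (1 + \<tau>) * cx\<^sup>2 * \<rho> / smin * (norm (0 :: real^'n))\<^sup>2
        + 8 * (1 + \<tau>) * \<rho> * kappa (transpose A ** A) * (norm (0 :: real^'m))\<^sup>2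
        + 8 * (1 + \<tau>) * (sigma_max Q)\<^sup>2 / (\<rho> * smin) * (norm (0 :: real^'n))\<^sup>2"
    unfolding Gamma_full_def Gamma_tilde_def dx_def[symmetric] dz_def[symmetric] dh_def[symmetric]
    by (intro tendsto_intros null)
  then have "Gamma_full Q A \<rho> cx \<tau> x xt z \<longlonglongrightarrow> 0" by simp
  then have "(\<lambda>k. aug (x (Suc k)) (z (Suc k)) (y (Suc k)) + Gamma_full Q A \<rho> cx \<tau> x xt z k)
      \<longlonglongrightarrow> qp_f Q p xs" using tendsto_add[OF aug] by fastforce
  then show "E_full Q p A l u \<rho> cx \<tau> x xt z y \<longlonglongrightarrow> ereal (qp_f Q p xs)"
    by (intro LIMSEQ_imp_Suc[of "E_full Q p A l u \<rho> cx \<tau> x xt z y"])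
      (simp add: E_full_def AugLagr_eq[OF z_feasible])
  show "E_tilde Q p A l u \<rho> cx \<tau> x xt z y \<longlonglongrightarrow> ereal (qp_f Q p xs)"
  proof (rule LIMSEQ_imp_Suc)
    have "E_tilde Q p A l u \<rho> cx \<tau> x xt z y (Suc k) = ereal (energy k)" for k
      by (simp add: E_tilde_def AugLagr_eq[OF z_feasible] energy_def)
    then show "(\<lambda>k. E_tilde Q p A l u \<rho> cx \<tau> x xt z y (Suc k)) \<longlonglongrightarrow> ereal (qp_f Q p xs)"
      using energy by simp
  qed
qed

theorem theorem1:
  fixes Q :: "real^'n^'n" and p :: "real^'n" and A :: "real^'n^'m"
    and l u :: "ereal^'m"
    and \<rho> \<beta>x \<beta>z cx cz \<delta> \<tau> :: real
    and x xt :: "nat \<Rightarrow> real^'n" and z y :: "nat \<Rightarrow> real^'m"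
  assumes "psd Q" and "sigma_max Q > 0"
    and "\<forall>i. l $ i \<noteq> \<infinity>" and "\<forall>i. u $ i \<noteq> -\<infinity>"
    and "\<rho> > 0" and "\<beta>x > 0" and "\<beta>z > 0" and "cx > 0" and "cz > 0"
    and "0 < \<tau>" and "\<tau> < \<delta>" and "\<delta> < 1"
    and "inexact_admm Q p A l u \<rho> \<beta>x \<beta>z cx cz \<delta> x xt z y"
    and "\<forall>w::real^'m. w \<in> range (\<lambda>v. A *v v)"
    and "\<forall>k. residual A x xt z k \<noteq> 0"
    and "psd ((\<beta>x * (1 - \<tau>) / (2 * (1 + \<tau>))
          - (2 * (sigma_max Q / \<rho> + cx)\<^sup>2 + 8 * cx\<^sup>2) / sigma_min (transpose A ** A))
            *\<^sub>R (mat 1 :: real^'n^'n))"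
    and "psd (((\<delta> - \<tau>) / (1 + \<tau>)
          - 8 * (sigma_max Q / \<rho>)\<^sup>2 / sigma_min (transpose A ** A))
            *\<^sub>R (mat 1 :: real^'n^'n))"
    and "psd ((\<beta>z * (1 - \<tau>) / (2 * (1 + \<tau>)) - 16 * kappa (transpose A ** A))
            *\<^sub>R (mat 1 :: real^'m^'m))"
    and "\<exists>B::real. \<forall>k\<ge>1. ereal B \<le> E_tilde Q p A l u \<rho> cx \<tau> x xt z y k"
  shows "(\<exists>F::real.
            (\<lambda>k. Lagr Q p A l u (x k) (z k) (y k)) \<longlonglongrightarrow> ereal F \<and>
            (\<lambda>k. AugLagr Q p A l u \<rho> (x k) (z k) (y k)) \<longlonglongrightarrow> ereal F \<and>
            E_full Q p A l u \<rho> cx \<tau> x xt z y \<longlonglongrightarrow> ereal F \<and>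
            E_tilde Q p A l u \<rho> cx \<tau> x xt z y \<longlonglongrightarrow> ereal F) \<and>
         (\<lambda>k. edist 0 (subdiff_Lagr Q p A l u (x k) (z k) (y k))) \<longlonglongrightarrow> 0 \<and>
         (\<lambda>k. edist 0 (subdiff_AugLagr Q p A l u \<rho> (x k) (z k) (y k))) \<longlonglongrightarrow> 0 \<and>
         (\<forall>xs zs ys.
            (\<exists>r :: nat \<Rightarrow> nat. strict_mono r \<and>
               ((\<lambda>k. (x k, z k, y k)) \<circ> r) \<longlonglongrightarrow> (xs, zs, ys)) \<longrightarrow>
            converges_sublinearly Q p A l u x z y xs zs ys \<and>
            qp_optimal Q p A l u xs \<and> zs = A *v xs)"
proof -
  interpret admm_run Q p A l u \<rho> \<beta>x \<beta>z cx cz \<delta> \<tau> x xt z y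
    using assms by unfold_locales (simp_all add: psd_scaled_identity)
  obtain xs zs ys where conv: "x \<longlonglongrightarrow> xs" "z \<longlonglongrightarrow> zs" "y \<longlonglongrightarrow> ys" and zs: "zs = A *v xs"
    and opt: "qp_optimal Q p A l u xs" and energy: "energy \<longlonglongrightarrow> qp_f Q p xs"
    and step: "summable step"
    by (rule iterates_converge)
  obtain M where
    M: "\<And>k. edist 0 (subdiff_Lagr Q p A l u (x (Suc k)) (z (Suc k)) (y (Suc k))) \<le> ereal (M * step k)"
    and M_aug: "\<And>k. edist 0 (subdiff_AugLagr Q p A l u \<rho> (x (Suc k)) (z (Suc k)) (y (Suc k)))
        \<le> ereal (M * step k)"
    by (rule stationarity_bound) blast
  have bound_sum: "summable (\<lambda>k. M * step k)" using step by (rule summable_mult)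
  then have bound0: "(\<lambda>k. M * step k) \<longlonglongrightarrow> 0" by (rule summable_LIMSEQ_zero)
  have triple: "(\<lambda>k. (x k, z k, y k)) \<longlonglongrightarrow> (xs, zs, ys)" by (intro tendsto_intros conv)
  have rate: "\<exists>C::real. \<forall>\<^sub>F K in sequentially.
      Min ((\<lambda>k. edist 0 (subdiff_Lagr Q p A l u (x k) (z k) (y k))) ` {1..K}) \<le> ereal (C / sqrt (real K))"
  proof (rule min_rate_of_square_summable)
    show "edist 0 (subdiff_Lagr Q p A l u (x k) (z k) (y k)) \<le> ereal (M * step (k - 1))" if "k \<ge> 1" for k
      using M[of "k - 1"] that by simp
    have "summable (\<lambda>k. (M * step k)\<^sup>2)" 
      unfolding power_mult_distrib
      by (intro summable_mult summable_power2 step) (simp add: step_def)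
    then show "summable (\<lambda>k. (M * step (k - 1))\<^sup>2)"
      using summable_Suc_iff[of "\<lambda>k. (M * step (k - 1))\<^sup>2"] by simp
  qed
  have limit_point: "converges_sublinearly Q p A l u x z y xs' zs' ys' \<and>
      qp_optimal Q p A l u xs' \<and> zs' = A *v xs'"
    if "strict_mono s" "((\<lambda>k. (x k, z k, y k)) \<circ> s) \<longlonglongrightarrow> (xs', zs', ys')" for s xs' zs' ys'
  proof -
    have "((\<lambda>k. (x k, z k, y k)) \<circ> s) \<longlonglongrightarrow> (xs, zs, ys)"
      using triple that(1) by (rule LIMSEQ_subseq_LIMSEQ)
    then have "(xs', zs', ys') = (xs, zs, ys)" using that(2) LIMSEQ_unique by blast
    then show ?thesis using triple rate opt zs by (simp add: converges_sublinearly_def)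
  qed
  show ?thesis
    using functionals_converge[OF conv zs energy step] limit_point
      tendsto_zero_edist[where C = "\<lambda>k. subdiff_Lagr Q p A l u (x k) (z k) (y k)", OF M bound0]
      tendsto_zero_edist[where C = "\<lambda>k. subdiff_AugLagr Q p A l u \<rho> (x k) (z k) (y k)", OF M_aug bound0]
    by blast
qed

end
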